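(* Let $\alpha,\beta\in[0,1]$ with $\alpha\le\beta$. Consider the two-user frequency-correlated MISO broadcast channel (two transmit antennas, one antenna per user) with the alternating two-subband imperfect CSIT pattern described in the context: in the first subband of each pair the CSIT of user 1 has quality $\beta$ and that of user 2 has quality $\alpha$, and in the second subband of each pair the CSIT of user 1 has quality $\alpha$ and that of user 2 has quality $\beta$. Then every DoF pair $(d_1,d_2)$ in the following region is achievable: the (convex) polygon in the nonnegative quadrant whose corner points, besides the origin $(0,0)$, are $$(1,0),\quad (0,1),\quad (1,\alpha),\quad (\alpha,1),$$ $$\left(\min\left(\tfrac{2+\alpha}{3},\beta\right),\ \max\left(\tfrac{2+\alpha}{3},\tfrac{2-\beta+\alpha}{2}\right)\right),$$ $$\left(\max\left(\tfrac{2+\alpha}{3},\tfrac{2-\beta+\alpha}{2}\right),\ \min\left(\tfrac{2+\alpha}{3},\beta\right)\right).$$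
   Context: Notation. For a positive function $f$ of the SNR $P$, $f(P)\sim P^{B}$ means $\lim_{P\to\infty}\frac{\log f(P)}{\log P}=B$. Logarithms are in base 2. $(\cdot)^H$ is the conjugate transpose, and $\hat{\mathbf h}^{\bot}$ denotes the (direction spanning the) orthogonal space of a vector $\hat{\mathbf h}\in\mathbb C^2$. Channel model. A transmitter with two antennas serves two users having one antenna each, over subbands $i=1,2,\dots$. In subband $i$ the transmitter sends $\mathbf s_i\in\mathbb C^2$, subject to the per-subband power constraint $\mathcal E[\|\mathbf s_i\|^2]\sim P$. Users 1 and 2 respectively receive $$y_i=\mathbf h_i^H\mathbf s_i+\epsilon_{i,y},\qquad z_i=\mathbf g_i^H\mathbf s_i+\epsilon_{i,z},$$ where $\epsilon_{i,y},\epsilon_{i,z}$ are unit-power additive white Gaussian noises. The channel vectors $\mathbf h_i$ (user 1) and $\mathbf g_i$ (user 2) in $\mathbb C^2$ are mutually independent and identically distributed with zero mean and covariance $\mathbf I_2$. The channels of one user on the two adjacent subbands of a pair may be correlated. Imperfect CSIT. The transmitter has channel estimates $\hat{\mathbf h}_i,\hat{\mathbf g}_i$ with errors $\tilde{\mathbf h}_i=\mathbf h_i-\hat{\mathbf h}_i$ and $\tilde{\mathbf g}_i=\mathbf g_i-\hat{\mathbf g}_i$, and error variances $\sigma_{h,i}^2=\mathcal E[\|\tilde{\mathbf h}_i\|^2]$ and $\sigma_{g,i}^2=\mathcal E[\|\tilde{\mathbf g}_i\|^2]$. The estimates $\hat{\mathbf h}_1$ and $\hat{\mathbf g}_2$ are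 reported by the users, and $\hat{\mathbf h}_2$ and $\hat{\mathbf g}_1$ are predicted from $\hat{\mathbf h}_1$ and $\hat{\mathbf g}_2$ respectively. The qualities are $$\beta=\lim_{P\to\infty}-\frac{\log\sigma_{h,1}^2}{\log P}=\lim_{P\to\infty}-\frac{\log\sigma_{g,2}^2}{\log P},\qquad \alpha=\lim_{P\to\infty}-\frac{\log\sigma_{h,2}^2}{\log P}=\lim_{P\to\infty}-\frac{\log\sigma_{g,1}^2}{\log P},$$ with $\alpha,\beta\in[0,1]$ and $\alpha\le\beta$ (0 corresponds to no CSIT, 1 to perfect CSIT). Moreover $\mathcal E[|\mathbf h_1^H\hat{\mathbf h}_1^{\bot}|^2]=\mathcal E[|\mathbf g_2^H\hat{\mathbf g}_2^{\bot}|^2]\sim P^{-\beta}$ and $\mathcal E[|\mathbf g_1^H\hat{\mathbf g}_1^{\bot}|^2]=\mathcal E[|\mathbf h_2^H\hat{\mathbf h}_2^{\bot}|^2]\sim P^{-\alpha}$. The two-subband pattern (subbands 1 and 2) can be repeated an arbitrary number $N$ of times: odd-numbered subbands have the CSIT qualities of subband 1 and even-numbered subbands those of subband 2. The transmitter and both users know all the estimates $\hat{\mathbf h}_{1:2N}$ and $\hat{\mathbf g}_{1:2N}$. In addition, each receiver knows its own channel vectors perfectly. Achievable DoF. A pair $(d_1,d_2)$ is achievable if there is a transmission scheme in which user $i$ decodes its own message at (achievable, in the Shannon sense) total rate $R_i$ over $S$ channel uses (one subband at full power $P$ counts as one channel use), with $$d_i=\lim_{P\to\infty}\frac{R_i}{S\log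 P},\qquad i=1,2.$$
   Formalization: The channel law is also assumed to give no mass to any complex line (true for Rayleigh fading or any density), since the claim fails e.g. if channels vanish with probability 1/2; channels together with their estimates are taken independent across users and pairs. *)

theory Defs
  imports "HOL-Probability.Probability"
begin

text \<open>
  Two users, two transmit antennas. Subbands are numbered from 0: the pair \<open>k\<close> consists of the
  subbands \<open>2 * k\<close> (the first, ``odd'' one in 1-based counting) and \<open>2 * k + 1\<close>.
\<close>

datatype user = User1 | User2

type_synonym cvec = "complex ^ 2"

text \<open>\<open>hdot h s\<close> is \<open>h\<close> conjugate-transposed times \<open>s\<close>.\<close>

definition hdot :: "cvec \<Rightarrow> cvec \<Rightarrow> complex" where
  "hdot h s = (\<Sum>j\<in>UNIV. cnj (h $ j) * s $ j)"

text \<open>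
  A unit vector \<open>w\<close> with \<open>hdot v w = 0\<close>; it is unique up to a unimodular factor if \<open>v \<noteq> 0\<close>, and
  for \<open>v = 0\<close> every unit vector qualifies.
\<close>

definition perp :: "cvec \<Rightarrow> cvec" where
  "perp v = (if v = 0 then axis 1 1
             else (1 / norm v) *\<^sub>R vector [- cnj (v $ 2), cnj (v $ 1)])"

lemma hdot_perp: "hdot v (perp v) = 0"
  by (simp add: hdot_def perp_def sum_2 vector_2)

lemma norm_perp: "norm (perp v) = 1"
proof (cases "v = 0")
  case False
  have "norm (vector [- cnj (v $ 2), cnj (v $ 1)] :: cvec) = norm v"
    by (simp add: norm_vec_def L2_set_def sum_2 add.commute)
  then show ?thesis using False by (simp add: perp_def)
qed (simp add: perp_def norm_axis_1)

text \<open>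
  The relation \<open>f(P) \<sim> P^B\<close>. Positivity is demanded because \<open>log 2 x = 0\<close> by convention at
  \<open>x = 0\<close>; it also forces expected values for which the relation is claimed to be those of
  integrable functions for large \<open>P\<close>.
\<close>

definition pow_sim :: "(real \<Rightarrow> real) \<Rightarrow> real \<Rightarrow> bool" where
  "pow_sim f B \<longleftrightarrow> (\<forall>\<^sub>F P in at_top. 0 < f P) \<and>
     ((\<lambda>P. log 2 (f P) / log 2 P) \<longlongrightarrow> B) at_top"

primrec msg :: "user \<Rightarrow> nat \<times> nat \<Rightarrow> nat" where
  "msg User1 m = fst m"
| "msg User2 m = snd m"

text \<open>Mean over two independent uniform messages, from \<open>K1\<close> and \<open>K2\<close> many values.\<close>

definition msg_avg :: "nat \<Rightarrow> nat \<Rightarrow> (nat \<times> nat \<Rightarrow> real) \<Rightarrow> real" where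
  "msg_avg K1 K2 f = (\<Sum>m\<in>{..<K1} \<times> {..<K2}. f m) / (real K1 * real K2)"

text \<open>
  \<open>H u P i\<close> and \<open>He u P i\<close> are the channel vector of user \<open>u\<close> on subband \<open>i\<close> and its estimate, at
  SNR \<open>P\<close>; \<open>Z u i\<close> is the receiver noise. Channels may depend on \<open>P\<close> only to let the correlation
  inside a pair vary with the SNR (their marginal law is fixed below).
\<close>

locale miso_bc = prob_space M for M :: "'w measure" +
  fixes H He :: "user \<Rightarrow> real \<Rightarrow> nat \<Rightarrow> 'w \<Rightarrow> cvec"
    and Z :: "user \<Rightarrow> nat \<Rightarrow> 'w \<Rightarrow> complex"
begin

definition err_var :: "user \<Rightarrow> real \<Rightarrow> nat \<Rightarrow> real" where
  "err_var u P i = expectation (\<lambda>\<omega>. (norm (H u P i \<omega> - He u P i \<omega>))\<^sup>2)"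

definition leak :: "user \<Rightarrow> real \<Rightarrow> nat \<Rightarrow> real" where
  "leak u P i = expectation (\<lambda>\<omega>. (cmod (hdot (H u P i \<omega>) (perp (He u P i \<omega>))))\<^sup>2)"

definition block :: "real \<Rightarrow> user \<times> nat \<Rightarrow> 'w \<Rightarrow> cvec \<times> cvec \<times> cvec \<times> cvec" where
  "block P = (\<lambda>(u, k) \<omega>. (H u P (2 * k) \<omega>, H u P (2 * k + 1) \<omega>,
                          He u P (2 * k) \<omega>, He u P (2 * k + 1) \<omega>))"

text \<open>All estimates on the first \<open>n\<close> subbands, known to the transmitter and to both users.\<close>

definition csit :: "real \<Rightarrow> nat \<Rightarrow> 'w \<Rightarrow> user \<times> nat \<Rightarrow> cvec" where
  "csit P n \<omega> = (\<lambda>(u, i)\<in>UNIV \<times> {..<n}. He u P i \<omega>)"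

definition own_csi :: "user \<Rightarrow> real \<Rightarrow> nat \<Rightarrow> 'w \<Rightarrow> nat \<Rightarrow> cvec" where
  "own_csi u P n \<omega> = (\<lambda>i\<in>{..<n}. H u P i \<omega>)"

definition received ::
  "user \<Rightarrow> real \<Rightarrow> nat \<Rightarrow> (nat \<Rightarrow> (user \<times> nat \<Rightarrow> cvec) \<Rightarrow> cvec) \<Rightarrow> 'w \<Rightarrow> nat \<Rightarrow> complex" where
  "received u P n s \<omega> = (\<lambda>i\<in>{..<n}. hdot (H u P i \<omega>) (s i (csit P n \<omega>)) + Z u i \<omega>)"

text \<open>
  A code for \<open>n\<close> subbands: \<open>enc m i c\<close> is the vector sent on subband \<open>i\<close> for the message pair \<open>m\<close>
  when the estimates are \<open>c\<close>. The mean transmit power on each subband lies between \<open>pmin\<close> and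
  \<open>pmax\<close>, and each user decodes its own message with error probability at most \<open>\<epsilon>\<close>.
\<close>

definition code_exists ::
  "real \<Rightarrow> nat \<Rightarrow> real \<Rightarrow> real \<Rightarrow> nat \<Rightarrow> nat \<Rightarrow> real \<Rightarrow> bool" where
  "code_exists P n pmin pmax K1 K2 \<epsilon> \<longleftrightarrow>
    (\<exists>(enc :: nat \<times> nat \<Rightarrow> nat \<Rightarrow> (user \<times> nat \<Rightarrow> cvec) \<Rightarrow> cvec)
      (dec :: user \<Rightarrow> (nat \<Rightarrow> complex) \<times> (nat \<Rightarrow> cvec) \<times> (user \<times> nat \<Rightarrow> cvec) \<Rightarrow> nat).
      (\<forall>m i. enc m i \<in> Pi\<^sub>M (UNIV \<times> {..<n}) (\<lambda>_. borel) \<rightarrow>\<^sub>M borel) \<and>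
      (\<forall>u. dec u \<in> Pi\<^sub>M {..<n} (\<lambda>_. borel) \<Otimes>\<^sub>M Pi\<^sub>M {..<n} (\<lambda>_. borel)
                     \<Otimes>\<^sub>M Pi\<^sub>M (UNIV \<times> {..<n}) (\<lambda>_. borel) \<rightarrow>\<^sub>M count_space UNIV) \<and>
      (\<forall>i<n. (\<forall>m\<in>{..<K1} \<times> {..<K2}. integrable M (\<lambda>\<omega>. (norm (enc m i (csit P n \<omega>)))\<^sup>2)) \<and>
             msg_avg K1 K2 (\<lambda>m. expectation (\<lambda>\<omega>. (norm (enc m i (csit P n \<omega>)))\<^sup>2))
               \<in> {pmin..pmax}) \<and>
      (\<forall>u. msg_avg K1 K2 (\<lambda>m. prob {\<omega> \<in> space M.
              dec u (received u P n (enc m) \<omega>, own_csi u P n \<omega>, csit P n \<omega>) \<noteq> msg u m}) \<le> \<epsilon>))"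

text \<open>
  \<open>(R1, R2)\<close> are total rates in bits per block of \<open>S\<close> channel uses, reliable as the number \<open>L\<close> of
  blocks grows while \<open>P\<close> is fixed.
\<close>

definition rates_achievable ::
  "real \<Rightarrow> nat \<Rightarrow> real \<Rightarrow> real \<Rightarrow> real \<Rightarrow> real \<Rightarrow> bool" where
  "rates_achievable P S pmin pmax R1 R2 \<longleftrightarrow> 0 \<le> R1 \<and> 0 \<le> R2 \<and>
    (\<forall>\<epsilon>>0. \<forall>\<^sub>F L in sequentially.
       code_exists P (L * S) pmin pmax
         (nat \<lceil>2 powr (real L * R1)\<rceil>) (nat \<lceil>2 powr (real L * R2)\<rceil>) \<epsilon>)"

text \<open>
  The power constraint is \<open>E(norm s_i)^2 \<sim> P\<close>, uniformly over subbands and block lengths: the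
  envelopes \<open>pmin\<close>, \<open>pmax\<close> depend on \<open>P\<close> only. A block consists of \<open>N\<close> repetitions of the
  two-subband pattern, i.e. of \<open>S = 2 * N\<close> channel uses.
\<close>

definition dof_achievable :: "real \<Rightarrow> real \<Rightarrow> bool" where
  "dof_achievable d1 d2 \<longleftrightarrow>
    (\<exists>N\<ge>1. \<exists>pmin pmax R1 R2. pow_sim pmin 1 \<and> pow_sim pmax 1 \<and>
       (\<forall>\<^sub>F P in at_top. rates_achievable P (2 * N) (pmin P) (pmax P) (R1 P) (R2 P)) \<and>
       ((\<lambda>P. R1 P / (real (2 * N) * log 2 P)) \<longlongrightarrow> d1) at_top \<and>
       ((\<lambda>P. R2 P / (real (2 * N) * log 2 P)) \<longlongrightarrow> d2) at_top)"

end

text \<open>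
  User 1 reports its channel on the first subband of each pair and user 2 on the second one; the
  estimates of a user on the other subband are predicted.
\<close>

definition reported :: "user \<Rightarrow> nat \<Rightarrow> bool" where
  "reported u i \<longleftrightarrow> (even i \<longleftrightarrow> u = User1)"

text \<open>
  The assumption \<open>law_nondegenerate\<close> (no complex line carries positive mass, as is the case for
  Rayleigh fading and for every law with a density) cannot be dropped: if the channel vectors
  vanish with positive probability, their mean and covariance can be as required and still not
  even \<open>(1, 0)\<close> is achievable.

  Assumption \<open>blocks_indep\<close> makes the two users and the different pairs independent and leaves
  the joint law inside a pair free. The noise density is that of a circularly symmetric complex
  Gaussian with unit power.
\<close>

locale alternating_csit = miso_bc M H He Z
  for M :: "'w measure" and H He Z +
  fixes \<mu> :: "cvec measure" and \<alpha> \<beta> :: real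
  assumes channel_measurable [measurable]: "P > 0 \<Longrightarrow> H u P i \<in> borel_measurable M"
    and estimate_measurable [measurable]: "P > 0 \<Longrightarrow> He u P i \<in> borel_measurable M"
    and noise_distributed:
      "distributed M lborel (Z u i) (\<lambda>z. ennreal (exp (- (cmod z)\<^sup>2) / pi))"
    and noise_indep: "indep_vars (\<lambda>_. borel) (\<lambda>(u, i). Z u i) UNIV"
    and blocks_indep: "P > 0 \<Longrightarrow> indep_vars (\<lambda>_. borel) (block P) UNIV"
    and noise_blocks_indep: "P > 0 \<Longrightarrow>
      indep_set
        (sets (vimage_algebra (space M) (\<lambda>\<omega> q. block P q \<omega>) (Pi\<^sub>M UNIV (\<lambda>_. borel))))
        (sets (vimage_algebra (space M) (\<lambda>\<omega> (u, i). Z u i \<omega>) (Pi\<^sub>M UNIV (\<lambda>_. borel))))"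
    and channel_law: "P > 0 \<Longrightarrow> distr M borel (H u P i) = \<mu>"
    and law_square_integrable: "integrable \<mu> (\<lambda>v. (norm v)\<^sup>2)"
    and law_mean: "\<And>j. (\<integral>v. v $ j \<partial>\<mu>) = 0"
    and law_covariance: "\<And>j k. (\<integral>v. v $ j * cnj (v $ k) \<partial>\<mu>) = (if j = k then 1 else 0)"
    and law_nondegenerate: "w \<noteq> 0 \<Longrightarrow> AE v in \<mu>. hdot v w \<noteq> 0"
    and error_square_integrable:
      "P > 0 \<Longrightarrow> integrable M (\<lambda>\<omega>. (norm (H u P i \<omega> - He u P i \<omega>))\<^sup>2)"
    and predicted:
      "\<lbrakk>P > 0; reported u i; \<not> reported u j; i div 2 = j div 2\<rbrakk> \<Longrightarrow>
         \<exists>\<phi>\<in>borel_measurable borel. AE \<omega> in M. He u P j \<omega> = \<phi> (He u P i \<omega>)"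
    and err_var_periodic: "P > 0 \<Longrightarrow> err_var u P i = err_var u P (i mod 2)"
    and err_var_quality: "pow_sim (\<lambda>P. err_var u P i) (- (if reported u i then \<beta> else \<alpha>))"
    and leak_eq: "\<lbrakk>P > 0; reported u i = reported u' i'\<rbrakk> \<Longrightarrow> leak u P i = leak u' P i'"
    and leak_quality: "pow_sim (\<lambda>P. leak u P i) (- (if reported u i then \<beta> else \<alpha>))"

definition dof_region :: "real \<Rightarrow> real \<Rightarrow> (real \<times> real) set" where
  "dof_region \<alpha> \<beta> = convex hull
     {(0, 0), (1, 0), (0, 1), (1, \<alpha>), (\<alpha>, 1),
      (min ((2 + \<alpha>) / 3) \<beta>, max ((2 + \<alpha>) / 3) ((2 - \<beta> + \<alpha>) / 2)),
      (max ((2 + \<alpha>) / 3) ((2 - \<beta> + \<alpha>) / 2), min ((2 + \<alpha>) / 3) \<beta>)}"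

end

theory Submission
  imports Defs
begin

text \<open>
  The region lies in the pentagon \<open>d1, d2 \<le> 1\<close>, \<open>d1 + d2 \<le> (2 + \<alpha> + \<beta>) / 2\<close>, all of which is
  achieved by coding over a single pair of subbands. On each subband every user gets a private
  symbol, sent orthogonally to the other user's channel estimate and with amplitude inverse to
  the root of the leakage, so that it disappears in the other user's noise. On top there is a
  common symbol and, in the gap between the powers of the two private symbols, a common symbol that
  is \<^emph>\<open>repeated\<close> on both subbands. On its reported subband a user resolves everything; on its predicted subband the
  repeated symbol, which collides with the user's own stronger private symbol, is then already
  known. In units of \<open>log P\<close> per pair, the common symbols carry \<open>2 - \<alpha> - \<beta>\<close>, shared out between
  the users at will, and the private ones carry \<open>\<alpha> + \<beta>\<close> for each user.

  All symbols are Gaussian integers with hard decisions, and powers of \<open>log P\<close> separate the levels.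
  A decision on one pair then fails with a probability \<open>\<eta> P\<close> that vanishes as \<open>P\<close> grows, and an outer
  Gilbert--Varshamov code of relative distance \<open>8 * \<eta> P\<close> corrects the failures at a vanishing cost in
  rate. Bad channels and bad noise are counted separately, so that only the independence inside
  each of the two families is needed.
\<close>

subsection \<open>Codes and grids\<close>

definition hamming :: "nat \<Rightarrow> (nat \<Rightarrow> 'a) \<Rightarrow> (nat \<Rightarrow> 'a) \<Rightarrow> nat" where
  "hamming L x y = card {k\<in>{..<L}. x k \<noteq> y k}"

lemma hamming_commute: "hamming L x y = hamming L y x"
  unfolding hamming_def by (rule arg_cong[where f = card]) auto

lemma hamming_triangle: "hamming L x z \<le> hamming L x y + hamming L y z"
proof -
  have "{k\<in>{..<L}. x k \<noteq> z k} \<subseteq> {k\<in>{..<L}. x k \<noteq> y k} \<union> {k\<in>{..<L}. y k \<noteq> z k}" by auto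
  then have "hamming L x z \<le> card ({k\<in>{..<L}. x k \<noteq> y k} \<union> {k\<in>{..<L}. y k \<noteq> z k})"
    unfolding hamming_def by (intro card_mono) auto
  also have "\<dots> \<le> hamming L x y + hamming L y z"
    unfolding hamming_def by (rule card_Un_le)
  finally show ?thesis .
qed

text \<open>Words are sorted by a set \<open>S\<close> outside which they agree with
  \<open>x\<close>: there are at most \<open>2 ^ L\<close> such sets, and each leaves at most
  \<open>Q ^ D\<close> words. The crude factor \<open>2 ^ L\<close> costs one bit per symbol, which
  is negligible against the logarithm of the SNR.\<close>

lemma card_hamming_ball:
  assumes "1 \<le> Q"
  shows "card {y \<in> {..<L} \<rightarrow>\<^sub>E {..<Q}. hamming L x y \<le> D} \<le> 2 ^ L * Q ^ D"
proof -
  let ?W = "{..<L} \<rightarrow>\<^sub>E {..<Q}"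
  let ?A = "\<lambda>S. {y \<in> ?W. \<forall>k\<in>{..<L} - S. y k = x k}"
  have fin: "finite ?W" by (intro finite_PiE) auto
  have "{y \<in> ?W. hamming L x y \<le> D} \<subseteq> (\<Union>S\<in>{S. S \<subseteq> {..<L} \<and> card S \<le> D}. ?A S)"
  proof
    fix y assume y: "y \<in> {y \<in> ?W. hamming L x y \<le> D}"
    show "y \<in> (\<Union>S\<in>{S. S \<subseteq> {..<L} \<and> card S \<le> D}. ?A S)"
      by (rule UN_I[of "{k\<in>{..<L}. x k \<noteq> y k}"]) (use y in \<open>auto simp: hamming_def\<close>)
  qed
  then have "card {y \<in> ?W. hamming L x y \<le> D} \<le> card (\<Union>S\<in>{S. S \<subseteq> {..<L} \<and> card S \<le> D}. ?A S)"
    using fin by (intro card_mono finite_UN_I) (simp_all add: finite_subset[of _ "Pow {..<L}"] Pow_def)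
  also have "\<dots> \<le> (\<Sum>S\<in>{S. S \<subseteq> {..<L} \<and> card S \<le> D}. card (?A S))"
    by (intro card_UN_le) simp
  also have "\<dots> \<le> (\<Sum>S\<in>{S. S \<subseteq> {..<L} \<and> card S \<le> D}. Q ^ D)"
  proof (intro sum_mono)
    fix S assume S: "S \<in> {S. S \<subseteq> {..<L} \<and> card S \<le> D}"
    then have finS: "finite S" by (auto intro: finite_subset)
    have "card (?A S) \<le> card (S \<rightarrow>\<^sub>E {..<Q})"
    \<comment> \<open>A word in \<open>?A S\<close> is determined by its values on \<open>S\<close>:
      on the rest of \<open>{..<L}\<close> it equals \<open>x\<close>, and beyond \<open>L\<close>
      extensionality fixes it to \<open>undefined\<close>.\<close>
    proof (rule card_inj_on_le[where f = "\<lambda>y. restrict y S"])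
      show "inj_on (\<lambda>y. restrict y S) (?A S)"
      proof (intro inj_onI ext)
        fix y y' k assume yy: "y \<in> ?A S" "y' \<in> ?A S" "restrict y S = restrict y' S"
        show "y k = y' k"
        proof (cases "k \<in> S")
          case True then show ?thesis using fun_cong[OF yy(3), of k] by simp
        next
          case False
          then show ?thesis using yy(1,2) by (cases "k < L") (auto simp: PiE_def extensional_def)
        qed
      qed
      show "finite (S \<rightarrow>\<^sub>E {..<Q})" using finS by (intro finite_PiE) auto
    qed (use S in auto)
    also have "\<dots> = Q ^ card S" using finS by (simp add: card_PiE)
    also have "\<dots> \<le> Q ^ D" using S assms by (intro power_increasing) auto
    finally show "card (?A S) \<le> Q ^ D" .
  qed
  also have "\<dots> = card {S. S \<subseteq> {..<L} \<and> card S \<le> D} * Q ^ D" by simp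
  also have "\<dots> \<le> card (Pow {..<L}) * Q ^ D"
    by (intro mult_right_mono card_mono) auto
  also have "\<dots> = 2 ^ L * Q ^ D" by (simp add: card_Pow)
  finally show ?thesis .
qed

text \<open>Greedy choice: as long as the balls of radius \<open>D\<close> around the codewords
  chosen so far do not fill the word space, any uncovered word can be added. The last of
  \<open>K\<close> words only has to avoid \<open>K - 1\<close> balls, whence the truncated
  difference in the hypothesis.\<close>

lemma gilbert_varshamov:
  assumes "1 \<le> Q" and "(K - 1) * (2 ^ L * Q ^ D) < Q ^ L"
  shows "\<exists>code :: nat \<Rightarrow> nat \<Rightarrow> nat. (\<forall>m<K. \<forall>k<L. code m k < Q) \<and>
    (\<forall>m<K. \<forall>m'<K. m \<noteq> m' \<longrightarrow> D < hamming L (code m) (code m'))"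
  using assms(2)
proof (induction K)
  case (Suc K)
  have le: "(K - 1) * (2 ^ L * Q ^ D) \<le> K * (2 ^ L * Q ^ D)" by (intro mult_right_mono) auto
  have lt: "K * (2 ^ L * Q ^ D) < Q ^ L" using Suc.prems by simp
  from Suc.IH[OF le_less_trans[OF le lt]] obtain code :: "nat \<Rightarrow> nat \<Rightarrow> nat" where
    c1: "\<And>m k. m < K \<Longrightarrow> k < L \<Longrightarrow> code m k < Q" and
    c2: "\<And>m m'. m < K \<Longrightarrow> m' < K \<Longrightarrow> m \<noteq> m' \<Longrightarrow> D < hamming L (code m) (code m')"
    by blast
  let ?W = "{..<L} \<rightarrow>\<^sub>E {..<Q}"
  let ?B = "\<Union>m<K. {y \<in> ?W. hamming L (code m) y \<le> D}"
  have "card ?B \<le> (\<Sum>m<K. card {y \<in> ?W. hamming L (code m) y \<le> D})"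
    by (intro card_UN_le) auto
  also have "\<dots> \<le> (\<Sum>m<K. 2 ^ L * Q ^ D)"
    by (intro sum_mono card_hamming_ball assms)
  also have "\<dots> < Q ^ L" using Suc.prems by simp
  also have "\<dots> = card ?W" by (simp add: card_PiE)
  finally have "card ?B < card ?W" .
  moreover have "finite ?B" by (intro finite_UN_I) (auto intro!: finite_PiE)
  ultimately have "\<not> ?W \<subseteq> ?B" using card_mono[of ?B ?W] by linarith
  then obtain y where y1: "y \<in> ?W" and y2: "y \<notin> ?B" by blast
  have y: "y \<in> ?W" "\<And>m. m < K \<Longrightarrow> D < hamming L (code m) y"
    using y1 y2 by (auto simp: not_le simp del: PiE_iff)
  show ?case
  proof (intro exI[of _ "code(K := y)"] conjI allI impI)
    fix m k assume "m < Suc K" "k < L"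
    then show "(code(K := y)) m k < Q" using c1 y(1) by (auto simp: less_Suc_eq)
  next
    fix m m' assume "m < Suc K" "m' < Suc K" "m \<noteq> m'"
    then show "D < hamming L ((code(K := y)) m) ((code(K := y)) m')"
      using c2 y(2) hamming_commute[of L y] by (auto simp: less_Suc_eq)
  qed
qed auto

section \<open>Finite grids of Gaussian integers\<close>

definition gauss_grid :: "nat \<Rightarrow> complex set" where
  "gauss_grid n = (\<lambda>(a, b). Complex (real a) (real b)) ` ({..n} \<times> {..n})"

lemma gauss_grid_diff_le:
  assumes "x \<in> gauss_grid n" "y \<in> gauss_grid n"
  shows "cmod (x - y) \<le> 2 * real n"
proof -
  have "\<bar>Re (x - y)\<bar> \<le> real n" "\<bar>Im (x - y)\<bar> \<le> real n"
    using assms by (auto simp: gauss_grid_def)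
  then show ?thesis using cmod_le[of "x - y"] by linarith
qed

lemma zero_in_gauss_grid: "0 \<in> gauss_grid n"
  unfolding gauss_grid_def by (rule image_eqI[of _ _ "(0, 0)"]) (auto simp: complex_eq_iff)

lemma gauss_grid_norm_le: "x \<in> gauss_grid n \<Longrightarrow> cmod x \<le> 2 * real n"
  using gauss_grid_diff_le[of x n 0] zero_in_gauss_grid by simp

text \<open>Distinct Gaussian integers differ by at least 1 in one coordinate. This minimum distance
  is what hard decisions rely on.\<close>

lemma gauss_grid_diff_ge:
  assumes "x \<in> gauss_grid n" "y \<in> gauss_grid n" "x \<noteq> y"
  shows "1 \<le> cmod (x - y)"
proof -
  obtain a b c d where x: "x = Complex (real a) (real b)" and y: "y = Complex (real c) (real d)"
    using assms by (auto simp: gauss_grid_def)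
  have "1 \<le> \<bar>real a - real c\<bar> \<or> 1 \<le> \<bar>real b - real d\<bar>"
    using assms(3) unfolding x y by (cases "a < c"; cases "c < a"; cases "b < d"; cases "d < b") auto
  then show ?thesis
    using abs_Re_le_cmod[of "x - y"] abs_Im_le_cmod[of "x - y"] by (auto simp: x y)
qed

lemma finite_gauss_grid [simp]: "finite (gauss_grid n)"
  by (simp add: gauss_grid_def)

lemma card_gauss_grid: "card (gauss_grid n) = (n + 1)\<^sup>2"
  unfolding gauss_grid_def
  by (subst card_image) (auto simp: inj_on_def power2_eq_square)

subsection \<open>Inner products and precoders\<close>

definition other :: "user \<Rightarrow> user" where
  "other u = (case u of User1 \<Rightarrow> User2 | User2 \<Rightarrow> User1)"

lemma other_simps [simp]: "other User1 = User2" "other User2 = User1" "other (other u) = u"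
  "other u \<noteq> u" "u \<noteq> other u"
  by (cases u; simp add: other_def)+

lemma hdot_add: "hdot h (v + w) = hdot h v + hdot h w"
  by (simp add: hdot_def sum_2 algebra_simps)

lemma hdot_diff: "hdot h (v - w) = hdot h v - hdot h w"
  by (simp add: hdot_def sum_2 algebra_simps)

lemma hdot_scale: "hdot h (z *s v) = z * hdot h v"
  by (simp add: hdot_def sum_2 algebra_simps)

lemma norm_scale_vec: "norm (z *s (v :: cvec)) = cmod z * norm v"
  by (simp add: norm_vec_def L2_set_def sum_2 norm_mult power_mult_distrib
      real_sqrt_mult flip: distrib_left)

lemma norm_hdot_le: "cmod (hdot h v) \<le> norm h * norm v"
proof -
  have "cmod (hdot h v) \<le> (\<Sum>j\<in>UNIV. \<bar>cmod (h $ j)\<bar> * \<bar>cmod (v $ j)\<bar>)"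
    unfolding hdot_def by (rule order_trans[OF norm_sum]) (simp add: norm_mult)
  also have "\<dots> \<le> norm h * norm v"
    unfolding norm_vec_def by (rule L2_set_mult_ineq)
  finally show ?thesis .
qed

lemma borel_measurable_hdot [measurable]:
  assumes [measurable]: "f \<in> borel_measurable N" "g \<in> borel_measurable N"
  shows "(\<lambda>x. hdot (f x) (g x)) \<in> borel_measurable N"
proof -
  have "(\<lambda>p :: cvec \<times> cvec. hdot (fst p) (snd p)) \<in> borel_measurable borel"
    unfolding hdot_def
    by (intro borel_measurable_continuous_onI continuous_intros)
  then have "(\<lambda>p :: cvec \<times> cvec. hdot (fst p) (snd p)) \<in> borel \<Otimes>\<^sub>M borel \<rightarrow>\<^sub>M borel"
    by (simp add: borel_prod)
  from measurable_compose[OF _ this, of "\<lambda>x. (f x, g x)" N] show ?thesis by simp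
qed

lemma borel_measurable_scale_vec [measurable]:
  assumes [measurable]: "g \<in> borel_measurable N"
  shows "(\<lambda>x. z *s (g x :: cvec)) \<in> borel_measurable N"
proof -
  have "(\<lambda>v. z *s (v :: cvec)) \<in> borel_measurable borel"
    unfolding vector_scalar_mult_def
    by (intro borel_measurable_continuous_onI continuous_intros)
  then show ?thesis by measurable
qed

lemma borel_measurable_perp [measurable]: "perp \<in> borel_measurable borel"
proof -
  \<comment> \<open>Rewriting \<open>vector\<close> as a componentwise abstraction makes the
    continuity rule for \<open>vec_lambda\<close> applicable; the jump of \<open>perp\<close> at 0
    is then left to the case distinction in its definition.\<close>
  have *: "(vector [- cnj (v $ 2), cnj (v $ 1)] :: cvec) = (\<chi> j. if j = 1 then - cnj (v $ 2) else cnj (v $ 1))"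
    for v :: cvec
    unfolding vec_eq_iff forall_2 by (simp add: vector_2)
  have "continuous_on UNIV (\<lambda>v :: cvec. if i = (1 :: 2) then - cnj (v $ 2) else cnj (v $ 1))" for i
    by (cases "i = 1") (auto intro!: continuous_intros)
  then have [measurable]: "(\<lambda>v :: cvec. vector [- cnj (v $ 2), cnj (v $ 1)] :: cvec) \<in> borel_measurable borel"
    unfolding * by (intro borel_measurable_continuous_onI continuous_on_vec_lambda)
  show ?thesis unfolding perp_def by measurable
qed

text \<open>One stage of successive decoding, for differences of symbols. A nonzero \<open>x\<close>
  would contribute at least \<open>A / t\<close> through a gain of at least \<open>1 / t\<close>,
  more than the tolerance \<open>e\<close> and the lower levels \<open>e'\<close> can cancel
  together.\<close>

lemma hierarchy_step:
  fixes x y n :: complex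
  assumes g: "1 / t \<le> cmod g" and t: "0 < t" and A: "0 \<le> A"
    and small: "cmod (g * (complex_of_real A * x) + r) \<le> e" and r: "cmod r \<le> e'"
    and ge: "t * (e + e') < A" and x: "x \<noteq> 0 \<Longrightarrow> 1 \<le> cmod x"
  shows "x = 0"
proof (rule ccontr)
  assume "x \<noteq> 0"
  then have x1: "1 \<le> cmod x" by (rule x)
  have "A / t \<le> cmod g * A" using mult_right_mono[OF g A] by simp
  also have "\<dots> \<le> cmod g * A * cmod x"
    using mult_left_mono[OF x1, of "cmod g * A"] A by simp
  also have "\<dots> = cmod (g * (complex_of_real A * x))" using A by (simp add: norm_mult)
  also have "\<dots> \<le> e + e'"
    using norm_triangle_ineq4[of "g * (complex_of_real A * x) + r" r] small r by simp
  finally have "A \<le> t * (e + e')" using t by (simp add: field_simps)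
  with ge show False by simp
qed

subsection \<open>Superposition of grids\<close>

lemma reported_add_even [simp]: "reported u (2 * k + j) = reported u j"
  by (simp add: reported_def)

lemma reported_other: "reported (other u) j \<longleftrightarrow> \<not> reported u j"
  by (cases u) (auto simp: reported_def)

text \<open>
  \<open>X b j\<close> is the common symbol of subband \<open>j\<close>, \<open>C b\<close> the repeated one and \<open>W u m j\<close> the private symbol
  of user \<open>u\<close>; a private symbol is confined to the grid of size \<open>a c\<close>, where \<open>c\<close> tells whether the
  channel of the \<^emph>\<open>other\<close> user is reported on that subband. The known offset \<open>Off\<close> dominates
  everything else, which bounds the power of every codeword from below.
\<close>

locale superposition =
  fixes t A B Off :: real and nx nc :: nat and a :: "bool \<Rightarrow> nat" and Q :: "user \<Rightarrow> nat"
    and X :: "nat \<times> nat \<Rightarrow> nat \<Rightarrow> complex" and C :: "nat \<times> nat \<Rightarrow> complex"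
    and W :: "user \<Rightarrow> nat \<Rightarrow> nat \<Rightarrow> complex"
  assumes t_ge: "8 \<le> t"
    and B_ge: "t ^ 6 * (real (a False) + 1) \<le> B"
    and A_ge: "t ^ 3 * (B * (real nc + 1) + t ^ 3 * (real (a True) + 1)) \<le> A"
    and Off_ge: "4 * (A * real nx + B * real nc + t ^ 3 * real (a False) + t ^ 3 * real (a True)) \<le> Off"
    and X_grid: "b \<in> {..<Q User1} \<times> {..<Q User2} \<Longrightarrow> j < 2 \<Longrightarrow> X b j \<in> gauss_grid nx"
    and C_grid: "b \<in> {..<Q User1} \<times> {..<Q User2} \<Longrightarrow> C b \<in> gauss_grid nc"
    and W_grid: "m < Q u \<Longrightarrow> j < 2 \<Longrightarrow> W u m j \<in> gauss_grid (a (reported (other u) j))"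
    and symbols_inj: "\<lbrakk>b \<in> {..<Q User1} \<times> {..<Q User2}; b' \<in> {..<Q User1} \<times> {..<Q User2};
        \<And>j. j < 2 \<Longrightarrow> X b j = X b' j; C b = C b';
        \<And>j. j < 2 \<Longrightarrow> W u (msg u b) j = W u (msg u b') j\<rbrakk> \<Longrightarrow> msg u b = msg u b'"
begin

text \<open>The common part uses a fixed antenna instead of the estimates, so that both users
  receive it at the full gain of their channels.\<close>

definition common :: "nat \<times> nat \<Rightarrow> nat \<Rightarrow> cvec" where
  "common b j = (of_real Off + of_real A * X b j + of_real B * C b) *s axis 1 1"

text \<open>The precoder depends on the estimate of the other user, at whom the symbol then arrives
  only through the estimation error. The factor \<open>t ^ 3\<close> lifts the grid spacing above
  tolerance and noise.\<close>

definition own_part :: "user \<Rightarrow> nat \<times> nat \<Rightarrow> nat \<Rightarrow> (user \<Rightarrow> cvec) \<Rightarrow> cvec" where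
  "own_part u b j c = (of_real (t ^ 3) * W u (msg u b) j) *s perp (c (other u))"

definition desired :: "user \<Rightarrow> nat \<times> nat \<Rightarrow> nat \<Rightarrow> (user \<Rightarrow> cvec) \<Rightarrow> cvec" where
  "desired u b j c = common b j + own_part u b j c"

definition signal :: "nat \<times> nat \<Rightarrow> nat \<Rightarrow> (user \<Rightarrow> cvec) \<Rightarrow> cvec" where
  "signal b j c = common b j + own_part User1 b j c + own_part User2 b j c"

lemma signal_eq: "signal b j c = desired u b j c + own_part (other u) b j c"
  by (cases u) (simp_all add: signal_def desired_def)

lemma msg_less: "b \<in> {..<Q User1} \<times> {..<Q User2} \<Longrightarrow> msg u b < Q u"
  by (cases u) auto

lemma t_powers: "t ^ 2 * 8 \<le> t ^ 3" "t ^ 5 * 8 \<le> t ^ 6" "t ^ 2 * 512 \<le> t ^ 5" "0 < t ^ 2"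
proof -
  have "t ^ n * 8 \<le> t ^ (n + 1)" for n
    using mult_left_mono[of 8 t "t ^ n"] t_ge by simp
  from this[of 2] this[of 3] this[of 4] this[of 5]
  show "t ^ 2 * 8 \<le> t ^ 3" "t ^ 5 * 8 \<le> t ^ 6" "t ^ 2 * 512 \<le> t ^ 5"
    by simp_all
  show "0 < t ^ 2" using t_ge by simp
qed

text \<open>This and the following gap lemmas have the shape \<open>t * (e + e') < A\<close>
  required by \<open>hierarchy_step\<close>: \<open>e = 6 * t\<close> is the decision tolerance, and
  \<open>e'\<close> bounds the unresolved lower levels by gain \<open>t\<close> times amplitude
  times grid diameter.\<close>

lemma B_gap: "t * (6 * t + t * (t ^ 3 * (2 * real (a False)))) < B"
proof -
  have "t * (6 * t + t * (t ^ 3 * (2 * real (a False)))) = 6 * t ^ 2 + 2 * t ^ 5 * real (a False)"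
    by (simp add: algebra_simps power_numeral_reduce)
  also have "2 * t ^ 5 * real (a False) \<le> t ^ 6 * real (a False)"
    using t_powers t_ge by (intro mult_right_mono) (auto simp: power_numeral_reduce)
  also have "6 * t ^ 2 + t ^ 6 * real (a False) < t ^ 6 + t ^ 6 * real (a False)"
    using t_powers by linarith
  finally show ?thesis using B_ge by (simp add: algebra_simps)
qed

lemma B_pos: "0 < B"
proof -
  have "0 < t ^ 6 * (real (a False) + 1)" using t_ge by (intro mult_pos_pos) auto
  with B_ge show ?thesis by linarith
qed

lemma A_gap_True: "t * (6 * t + t * (t ^ 3 * (2 * real (a True)))) < A"
proof -
  have "t * (6 * t + t * (t ^ 3 * (2 * real (a True)))) = 6 * t ^ 2 + 2 * t ^ 5 * real (a True)"
    by (simp add: algebra_simps power_numeral_reduce)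
  also have "2 * t ^ 5 * real (a True) \<le> t ^ 6 * real (a True)"
    using t_powers t_ge by (intro mult_right_mono) (auto simp: power_numeral_reduce)
  also have "6 * t ^ 2 + t ^ 6 * real (a True) < t ^ 6 + t ^ 6 * real (a True)"
    using t_powers by linarith
  also have "\<dots> = t ^ 3 * (t ^ 3 * (real (a True) + 1))"
    by (simp add: algebra_simps power_numeral_reduce)
  also have "\<dots> \<le> t ^ 3 * (B * (real nc + 1) + t ^ 3 * (real (a True) + 1))"
    using B_pos t_ge by (intro mult_left_mono) auto
  finally show ?thesis using A_ge by linarith
qed

text \<open>This is the gap on the reported subband of a user, where the common symbol must stand
  out from the still unknown repeated symbol and from the weaker private grid.\<close>

lemma A_gap_False:
  "t * (6 * t + t * (B * (2 * real nc) + t ^ 3 * (2 * real (a False)))) < A"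
proof -
  have "t * (6 * t + t * (B * (2 * real nc) + t ^ 3 * (2 * real (a False)))) =
      t * (6 * t + t * (t ^ 3 * (2 * real (a False)))) + 2 * t ^ 2 * (B * real nc)"
    by (simp add: algebra_simps power2_eq_square)
  moreover have "2 * t ^ 2 * (B * real nc) \<le> t ^ 3 * (B * real nc)"
    using t_powers(1,4) B_pos by (intro mult_right_mono mult_nonneg_nonneg) linarith+
  moreover have "B \<le> t ^ 3 * B" using B_pos t_ge by (simp add: one_le_power)
  moreover have "t ^ 3 * (B * (real nc + 1)) = t ^ 3 * (B * real nc) + t ^ 3 * B"
    by (simp add: algebra_simps)
  ultimately have "t * (6 * t + t * (B * (2 * real nc) + t ^ 3 * (2 * real (a False))))
      < t ^ 3 * (B * (real nc + 1))" using B_gap by linarith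
  also have "\<dots> \<le> t ^ 3 * (B * (real nc + 1) + t ^ 3 * (real (a True) + 1))"
    using B_pos t_ge by (intro mult_left_mono) auto
  finally show ?thesis using A_ge by linarith
qed

lemma A_pos: "0 < A"
proof -
  have "0 \<le> t * (6 * t + t * (t ^ 3 * (2 * real (a True))))" using t_ge by simp
  with A_gap_True show ?thesis by linarith
qed

lemma t3_gap: "t * (6 * t + 0) < t ^ 3"
  using t_powers by (simp add: power2_eq_square)

text \<open>The received signal is affine in the symbols and the offset cancels, so only the
  differences \<open>dX\<close>, \<open>dC\<close>, \<open>dW\<close> matter, each of which is 0 or
  at least 1 in modulus. The gaps force them to 0 one after another. The bound \<open>6 * t\<close>
  is twice the tolerance \<open>3 * t\<close> of the detector.\<close>

lemma detection_unique:
  assumes b: "b \<in> {..<Q User1} \<times> {..<Q User2}" "b' \<in> {..<Q User1} \<times> {..<Q User2}"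
    and norm_h: "\<And>j. j < 2 \<Longrightarrow> norm (h j) \<le> t"
    and gain0: "\<And>j. j < 2 \<Longrightarrow> 1 / t \<le> cmod (hdot (h j) (axis 1 1))"
    and gain1: "\<And>j. j < 2 \<Longrightarrow> 1 / t \<le> cmod (hdot (h j) (perp (c j (other u))))"
    and close: "\<And>j. j < 2 \<Longrightarrow>
      cmod (hdot (h j) (desired u b j (c j)) - hdot (h j) (desired u b' j (c j))) \<le> 6 * t"
  shows "msg u b = msg u b'"
proof -
  define g where "g j = hdot (h j) (axis 1 1)" for j
  define p where "p j = hdot (h j) (perp (c j (other u)))" for j
  define dX where "dX j = X b j - X b' j" for j
  define dC where "dC = C b - C b'"
  define dW where "dW j = W u (msg u b) j - W u (msg u b') j" for j
  have t0: "0 < t" and t3: "0 \<le> t ^ 3" using t_ge by auto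
  have gle: "cmod (g j) \<le> t" if "j < 2" for j
    using norm_hdot_le[of "h j" "axis 1 1"] norm_h[OF that] by (simp add: g_def norm_axis_1)
  have ple: "cmod (p j) \<le> t" if "j < 2" for j
    using norm_hdot_le[of "h j" "perp (c j (other u))"] norm_h[OF that] by (simp add: p_def norm_perp)
  have gge: "1 / t \<le> cmod (g j)" and pge: "1 / t \<le> cmod (p j)" if "j < 2" for j
    using gain0[OF that] gain1[OF that] by (simp_all add: g_def p_def)
  have d: "cmod (g j * (of_real A * dX j) + (g j * (of_real B * dC) + p j * (of_real (t ^ 3) * dW j))) \<le> 6 * t"
    if "j < 2" for j
  proof -
    have "hdot (h j) (desired u b j (c j)) - hdot (h j) (desired u b' j (c j)) =
      g j * (of_real A * dX j) + (g j * (of_real B * dC) + p j * (of_real (t ^ 3) * dW j))"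
      by (simp add: desired_def common_def own_part_def hdot_add hdot_scale g_def p_def dX_def
          dC_def dW_def algebra_simps)
    with close[OF that] show ?thesis by simp
  qed
  have dX1: "1 \<le> cmod (dX j)" if "j < 2" "dX j \<noteq> 0" for j
    using gauss_grid_diff_ge[OF X_grid[OF b(1) that(1)] X_grid[OF b(2) that(1)]] that
    by (simp add: dX_def)
  have dC1: "1 \<le> cmod dC" if "dC \<noteq> 0"
    using gauss_grid_diff_ge[OF C_grid[OF b(1)] C_grid[OF b(2)]] that by (simp add: dC_def)
  note Wg = W_grid[OF msg_less[OF b(1)], of _ u] W_grid[OF msg_less[OF b(2)], of _ u]
  have dW1: "1 \<le> cmod (dW j)" if "j < 2" "dW j \<noteq> 0" for j
    using gauss_grid_diff_ge[OF Wg(1,2)[OF that(1)]] that by (simp add: dW_def)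
  have dC2: "cmod dC \<le> 2 * real nc"
    using gauss_grid_diff_le[OF C_grid[OF b(1)] C_grid[OF b(2)]] by (simp add: dC_def)
  have dW2: "cmod (dW j) \<le> 2 * real (a (reported (other u) j))" if "j < 2" for j
    using gauss_grid_diff_le[OF Wg(1,2)[OF that(1)]] by (simp add: dW_def)
  have gC: "cmod (g j * (of_real B * dC)) \<le> t * (B * (2 * real nc))" if "j < 2" for j
    using mult_mono[OF gle[OF that] mult_left_mono[OF dC2, of B]] B_pos t0 by (simp add: norm_mult)
  have pW: "cmod (p j * (of_real (t ^ 3) * dW j)) \<le> t * (t ^ 3 * (2 * real (a (reported (other u) j))))"
    if "j < 2" for j
    using mult_mono[OF ple[OF that] mult_left_mono[OF dW2[OF that] t3]] t0
    by (simp add: norm_mult norm_power)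
  \<comment> \<open>With subbands counted from 0, \<open>r\<close> is the one whose channel
    \<open>u\<close> reports and \<open>q\<close> is the one with a predicted estimate.\<close>
  define r where "r = (if u = User1 then 0 else 1 :: nat)"
  define q where "q = 1 - r"
  have r: "r < 2" "\<not> reported (other u) r" and q: "q < 2" "reported (other u) q"
    by (cases u; simp add: r_def q_def reported_def)+
  have all: "j = r \<or> j = q" if "j < 2" for j
    using that by (cases u) (auto simp: r_def q_def)
  \<comment> \<open>successive resolution, first on the reported subband \<open>r\<close>, where the private symbol is weakest\<close>
  have Xr: "dX r = 0"
  proof (rule hierarchy_step[OF gge[OF r(1)] t0 less_imp_le[OF A_pos] d[OF r(1)] _ _ dX1[OF r(1)]])
    show "cmod (g r * (of_real B * dC) + p r * (of_real (t ^ 3) * dW r))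
        \<le> t * (B * (2 * real nc) + t ^ 3 * (2 * real (a False)))"
      using norm_triangle_mono[OF gC[OF r(1)] pW[OF r(1)]] r by (simp add: algebra_simps)
    show "t * (6 * t + t * (B * (2 * real nc) + t ^ 3 * (2 * real (a False)))) < A"
      by (rule A_gap_False)
  qed
  have C0: "dC = 0"
  proof (rule hierarchy_step[OF gge[OF r(1)] t0 less_imp_le[OF B_pos] _ _ B_gap dC1])
    show "cmod (g r * (of_real B * dC) + p r * (of_real (t ^ 3) * dW r)) \<le> 6 * t"
      using d[OF r(1)] Xr by simp
    show "cmod (p r * (of_real (t ^ 3) * dW r)) \<le> t * (t ^ 3 * (2 * real (a False)))"
      using pW[OF r(1)] r by simp
  qed
  have Wr: "dW r = 0"
    by (rule hierarchy_step[OF pge[OF r(1)] t0 t3 _ _ t3_gap dW1[OF r(1)], where r = 0])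
      (use d[OF r(1)] Xr C0 in simp_all)
  \<comment> \<open>This is where the repetition pays: \<open>dC = 0\<close> is known from subband
    \<open>r\<close>, so on \<open>q\<close> only the stronger private symbol lies below the common
    one. Resolving the repeated symbol here would fail, as the private one may exceed it.\<close>
  have Xq: "dX q = 0"
  proof (rule hierarchy_step[OF gge[OF q(1)] t0 less_imp_le[OF A_pos] _ _ A_gap_True dX1[OF q(1)]])
    show "cmod (g q * (of_real A * dX q) + p q * (of_real (t ^ 3) * dW q)) \<le> 6 * t"
      using d[OF q(1)] C0 by simp
    show "cmod (p q * (of_real (t ^ 3) * dW q)) \<le> t * (t ^ 3 * (2 * real (a True)))"
      using pW[OF q(1)] q by simp
  qed
  have Wq: "dW q = 0"
    by (rule hierarchy_step[OF pge[OF q(1)] t0 t3 _ _ t3_gap dW1[OF q(1)], where r = 0])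
      (use d[OF q(1)] Xq C0 in simp_all)
  show ?thesis
    by (rule symbols_inj[OF b])
      (use Xr Xq Wr Wq C0 all in \<open>auto simp: dX_def dC_def dW_def\<close>)
qed

text \<open>All parts other than the offset have total norm at most \<open>Off / 2\<close>. The
  bounds hold for every message pair and every estimate, so power needs no averaging
  argument.\<close>

lemma norm_signal:
  assumes "b \<in> {..<Q User1} \<times> {..<Q User2}" "j < 2"
  shows "Off / 2 \<le> norm (signal b j c)" "norm (signal b j c) \<le> 2 * Off"
proof -
  define s where "s = (of_real A * X b j + of_real B * C b) *s axis 1 (1::complex)
    + own_part User1 b j c + own_part User2 b j c"
  have "norm (own_part u b j c) \<le> t ^ 3 * (2 * real (a (reported (other u) j)))" for u
    using gauss_grid_norm_le[OF W_grid[OF msg_less[OF assms(1)] assms(2)]] t_ge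
    by (auto simp: own_part_def norm_scale_vec norm_perp norm_mult norm_power intro!: mult_left_mono)
  from this[of User1] this[of User2]
  \<comment> \<open>On each subband exactly one user reports, so one private symbol uses the grid of
    size \<open>a False\<close> and the other one that of size \<open>a True\<close>.\<close>
  have 1: "norm (own_part User1 b j c) + norm (own_part User2 b j c)
      \<le> t ^ 3 * (2 * real (a False)) + t ^ 3 * (2 * real (a True))"
    using reported_other[of User1 j] by (cases "reported User1 j") auto
  have 2: "norm ((of_real A * X b j + of_real B * C b) *s axis 1 (1::complex) :: cvec)
      \<le> A * (2 * real nx) + B * (2 * real nc)"
    using gauss_grid_norm_le[OF X_grid[OF assms]] gauss_grid_norm_le[OF C_grid[OF assms(1)]] A_pos B_pos
    by (auto simp: norm_scale_vec norm_axis_1 norm_mult intro!: norm_triangle_mono mult_left_mono)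
  have 3: "2 * (A * (2 * real nx) + B * (2 * real nc) + (t ^ 3 * (2 * real (a False))
      + t ^ 3 * (2 * real (a True)))) \<le> Off"
    using Off_ge by (simp add: algebra_simps)
  have s: "norm s \<le> Off / 2"
    using order_trans[OF norm_triangle_ineq add_right_mono[OF norm_triangle_ineq]] 
      add_mono[OF 2 1] 3 unfolding s_def by (smt (verit) field_sum_of_halves)
  then have "0 \<le> Off" using norm_ge_zero[of s] by linarith
  then have Off: "norm (of_real Off *s axis 1 (1::complex) :: cvec) = Off"
    by (simp add: norm_scale_vec norm_axis_1)
  have eq: "signal b j c = of_real Off *s axis 1 (1::complex) + s"
    by (simp add: signal_def common_def s_def vec_eq_iff algebra_simps)
  show "Off / 2 \<le> norm (signal b j c)"
    using norm_triangle_ineq2[of "of_real Off *s axis 1 (1::complex) :: cvec" "- s"] s Off by (simp add: eq)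
  show "norm (signal b j c) \<le> 2 * Off"
    using norm_triangle_ineq[of "of_real Off *s axis 1 (1::complex) :: cvec" s] s Off \<open>0 \<le> Off\<close> by (simp add: eq)
qed

end

subsection \<open>Tail bounds\<close>

text \<open>Hoeffding's inequality for a deviation of \<open>\<eta> * real L\<close> above the mean,
  which is itself at most \<open>\<eta> * real L\<close>.\<close>

lemma (in prob_space) indep_sum_tail:
  fixes I :: "nat \<Rightarrow> 'a \<Rightarrow> real"
  assumes ind: "indep_vars (\<lambda>_. borel) I UNIV"
    and I01: "\<And>k \<omega>. I k \<omega> \<in> {0..1}"
    and E: "\<And>k. expectation (I k) \<le> \<eta>" and "0 < \<eta>" "0 < L"
  shows "prob {\<omega> \<in> space M. 2 * \<eta> * real L \<le> (\<Sum>k<L. I k \<omega>)} \<le> exp (- 2 * \<eta>\<^sup>2 * real L)"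
proof -
  interpret Hoeffding_ineq M "{..<L}" I "\<lambda>_. 0" "\<lambda>_. 1" "\<Sum>k<L. expectation (I k)"
    by unfold_locales (use indep_vars_subset[OF ind, of "{..<L}"] I01 in auto)
  have sum_le: "(\<Sum>k<L. expectation (I k)) \<le> real L * \<eta>"
    using sum_bounded_above[of "{..<L}" "\<lambda>k. expectation (I k)" \<eta>] E by simp
  have "prob {\<omega> \<in> space M. 2 * \<eta> * real L \<le> (\<Sum>k<L. I k \<omega>)}
      \<le> prob {\<omega> \<in> space M. (\<Sum>k<L. expectation (I k)) + \<eta> * real L \<le> (\<Sum>k<L. I k \<omega>)}"
  proof (rule finite_measure_mono)
    have [measurable]: "I k \<in> borel_measurable M" for k
      using ind by (auto simp: indep_vars_def)
    show "{\<omega> \<in> space M. (\<Sum>k<L. expectation (I k)) + \<eta> * real L \<le> (\<Sum>k<L. I k \<omega>)} \<in> events"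
      by measurable
  qed (use sum_le in \<open>auto simp: algebra_simps\<close>)
  also have "\<dots> \<le> exp (- 2 * (\<eta> * real L)\<^sup>2 / (\<Sum>k<L. (1 - 0)\<^sup>2))"
    by (rule Hoeffding_ineq_ge) (use assms in auto)
  also have "\<dots> = exp (- 2 * \<eta>\<^sup>2 * real L)"
    using \<open>0 < L\<close> by (simp add: power2_eq_square)
  finally show ?thesis .
qed

text \<open>Events that depend on disjoint groups of independent variables are independent, so their
  indicators satisfy the tail bound for sums.\<close>

lemma (in prob_space) indep_groups_count_tail:
  fixes Y :: "'i \<Rightarrow> 'a \<Rightarrow> 'b" and K :: "nat \<Rightarrow> 'i set"
  assumes ind: "indep_vars (\<lambda>_. N) Y UNIV" and K: "disjoint_family K"
    and A: "\<And>k. A k \<in> sets (Pi\<^sub>M (K k) (\<lambda>_. N))"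
    and p: "\<And>k. prob {\<omega> \<in> space M. restrict (\<lambda>i. Y i \<omega>) (K k) \<in> A k} \<le> \<eta>" and "0 < \<eta>" "0 < L"
  shows "prob {\<omega> \<in> space M. 2 * \<eta> * real L \<le> real (card {k\<in>{..<L}. restrict (\<lambda>i. Y i \<omega>) (K k) \<in> A k})}
    \<le> exp (- 2 * \<eta>\<^sup>2 * real L)"
proof -
  define I :: "nat \<Rightarrow> 'a \<Rightarrow> real" where "I k \<omega> = indicator (A k) (restrict (\<lambda>i. Y i \<omega>) (K k))" for k \<omega>
  have r: "indep_vars (\<lambda>k. Pi\<^sub>M (K k) (\<lambda>_. N)) (\<lambda>k \<omega>. restrict (\<lambda>i. Y i \<omega>) (K k)) UNIV"
    using indep_vars_restrict[OF ind, of UNIV K] K by auto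
  have I: "indep_vars (\<lambda>_. borel) I UNIV"
    unfolding I_def by (rule indep_vars_compose2[OF r]) (use A in measurable)
  have meas: "{\<omega> \<in> space M. restrict (\<lambda>i. Y i \<omega>) (K k) \<in> A k} \<in> events" for k
    using measurable_sets[OF _ A, of "\<lambda>\<omega>. restrict (\<lambda>i. Y i \<omega>) (K k)" M k] r
    by (auto simp: indep_vars_def vimage_def Int_def conj_commute)
  have "expectation (I k) = prob {\<omega> \<in> space M. restrict (\<lambda>i. Y i \<omega>) (K k) \<in> A k}" for k
  proof -
    have "expectation (I k) = expectation (indicator {\<omega> \<in> space M. restrict (\<lambda>i. Y i \<omega>) (K k) \<in> A k})"
      by (intro Bochner_Integration.integral_cong) (auto simp: I_def indicator_def)
    then show ?thesis using meas[of k] by simp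
  qed
  then have "prob {\<omega> \<in> space M. 2 * \<eta> * real L \<le> (\<Sum>k<L. I k \<omega>)} \<le> exp (- 2 * \<eta>\<^sup>2 * real L)"
    using p assms(5,6) by (intro indep_sum_tail[OF I]) (auto simp: I_def)
  moreover have "(\<Sum>k<L. I k \<omega>) = real (card {k\<in>{..<L}. restrict (\<lambda>i. Y i \<omega>) (K k) \<in> A k})" for \<omega>
    unfolding I_def indicator_def of_bool_def
    by (subst sum.If_cases) (auto intro!: arg_cong[where f = card])
  ultimately show ?thesis by simp
qed

section \<open>Small-ball probabilities of the channel law\<close>

definition small_ball :: "cvec measure \<Rightarrow> real \<Rightarrow> real" where
  "small_ball \<mu> \<delta> = (SUP w\<in>sphere 0 1. measure \<mu> {v. cmod (hdot v w) < \<delta>})"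

lemma sphere_cvec_nonempty: "sphere (0 :: cvec) 1 \<noteq> {}"
  using norm_perp[of 0] by (metis empty_iff mem_sphere_0)

text \<open>Since the supremum runs over all unit directions, the bound also serves for a random
  precoder once one conditions on it.\<close>

lemma small_ball_ge:
  assumes "prob_space \<mu>" "norm w = 1"
  shows "measure \<mu> {v. cmod (hdot v w) < \<delta>} \<le> small_ball \<mu> \<delta>"
  unfolding small_ball_def
  by (rule cSUP_upper) (use assms in \<open>auto intro!: bdd_aboveI2[of _ _ 1] prob_space.prob_le_1\<close>)

lemma small_ball_nonneg: "prob_space \<mu> \<Longrightarrow> 0 \<le> small_ball \<mu> \<delta>"
  by (rule order_trans[OF measure_nonneg small_ball_ge[OF _ norm_perp[of 0]]])

text \<open>Continuity from above along the sequence of inverses, transferred to the real parameter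
  by monotonicity.\<close>

lemma measure_tendsto_0:
  fixes S :: "real \<Rightarrow> 'a set"
  assumes "finite_measure \<mu>" and S: "\<And>e. S e \<in> sets \<mu>" and mono: "\<And>d e. d \<le> e \<Longrightarrow> S d \<subseteq> S e"
    and null: "measure \<mu> (\<Inter>n. S (inverse (real (Suc n)))) = 0"
  shows "((\<lambda>e. measure \<mu> (S e)) \<longlongrightarrow> 0) (at_right 0)"
proof -
  interpret finite_measure \<mu> by fact
  have "(\<lambda>n. measure \<mu> (S (inverse (real (Suc n))))) \<longlonglongrightarrow> measure \<mu> (\<Inter>n. S (inverse (real (Suc n))))"
    by (rule finite_Lim_measure_decseq) (use S in \<open>auto simp: decseq_def intro!: mono le_imp_inverse_le\<close>)
  then have lim: "(\<lambda>n. measure \<mu> (S (inverse (real (Suc n))))) \<longlonglongrightarrow> 0" by (simp only: null)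
  show ?thesis
  proof (rule tendstoI)
    fix r :: real assume "0 < r"
    then obtain n where n: "measure \<mu> (S (inverse (real (Suc n)))) < r"
      using order_tendstoD(2)[OF lim, of r] by (auto simp: eventually_sequentially)
    have "\<forall>\<^sub>F e in at_right 0. e < inverse (real (Suc n))"
      by (rule order_tendstoD(2)[OF tendsto_ident_at]) simp
    then show "\<forall>\<^sub>F e in at_right 0. dist (measure \<mu> (S e)) 0 < r"
    proof eventually_elim
      case (elim e)
      then have "measure \<mu> (S e) \<le> measure \<mu> (S (inverse (real (Suc n))))"
        by (intro finite_measure_mono mono S) simp
      with n show ?case by simp
    qed
  qed
qed

lemma measure_norm_tail_tendsto_0:
  fixes \<mu> :: "'a :: real_normed_vector measure"
  assumes "finite_measure \<mu>" "sets \<mu> = sets borel"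
  shows "((\<lambda>e. measure \<mu> {v. 1 < e * norm v}) \<longlongrightarrow> 0) (at_right 0)"
proof -
  have "((\<lambda>e. measure \<mu> {v. 1 < max 0 e * norm v}) \<longlongrightarrow> 0) (at_right 0)"
  proof (rule measure_tendsto_0[OF assms(1)])
    show "{v. 1 < max 0 e * norm v} \<in> sets \<mu>" for e :: real
    proof -
      have "open {v :: 'a. 1 < max 0 e * norm v}" by (intro open_Collect_less continuous_intros)
      then show ?thesis unfolding assms(2) by auto
    qed
    show "{v. 1 < max 0 d * norm v} \<subseteq> {v. 1 < max 0 e * norm v}" if "d \<le> e" for d e :: real
      using that by (intro Collect_mono impI) (erule less_le_trans, rule mult_right_mono, simp_all)
    have "(\<Inter>n. {v :: 'a. 1 < max 0 (inverse (real (Suc n))) * norm v}) = {}"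
    proof (intro equalityI subsetI)
      fix v :: 'a assume v: "v \<in> (\<Inter>n. {v. 1 < max 0 (inverse (real (Suc n))) * norm v})"
      obtain n where "norm v < real n" using reals_Archimedean2 by blast
      moreover have "real (Suc n) < norm v" using v by (auto simp: field_simps)
      ultimately show "v \<in> {}" by simp
    qed simp
    then show "measure \<mu> (\<Inter>n. {v. 1 < max 0 (inverse (real (Suc n))) * norm v}) = 0" by simp
  qed
  moreover have "\<forall>\<^sub>F e in at_right 0. measure \<mu> {v. 1 < max 0 e * norm v} = measure \<mu> {v. 1 < e * norm v}"
    using eventually_at_right_less[of "0::real"] by eventually_elim simp
  ultimately show ?thesis by (rule Lim_transform_eventually)
qed

text \<open>For a fixed direction, nondegeneracy and continuity from above suffice. Compactness of
  the sphere makes this uniform: finitely many directions approximate all others, up to an error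
  controlled by \<open>norm v\<close>, which is large only with small probability.\<close>

lemma small_ball_tendsto_0:
  assumes "prob_space \<mu>" and sets [measurable_cong]: "sets \<mu> = sets borel"
    and nondeg: "\<And>w. w \<noteq> 0 \<Longrightarrow> AE v in \<mu>. hdot v w \<noteq> 0"
  shows "(small_ball \<mu> \<longlongrightarrow> 0) (at_right 0)"
proof (rule tendstoI)
  interpret prob_space \<mu> by fact
  fix r :: real assume r: "0 < r"
  have [measurable]: "{v. cmod (hdot v w) < e} \<in> sets \<mu>" for w e
    using measurable_sets[of "\<lambda>v. cmod (hdot v w)" borel borel "{..<e}"]
    by (simp add: sets vimage_def)
  have tail: "((\<lambda>e. prob {v. 1 < e * norm v}) \<longlongrightarrow> 0) (at_right 0)"
    by (rule measure_norm_tail_tendsto_0) (use sets finite_measure_axioms in auto)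
  have "\<forall>\<^sub>F e in at_right 0. prob {v. 1 < e * norm v} < r / 4 \<and> 0 < e"
    using order_tendstoD(2)[OF tail, of "r / 4"] r eventually_at_right_less[of "0::real"]
    by (auto elim: eventually_elim2)
  then obtain e where e: "prob {v. 1 < e * norm v} < r / 4" "0 < e"
    using eventually_happens'[of "at_right (0::real)"] by fastforce
  \<comment> \<open>The factor 2 leaves room \<open>d\<close> for replacing \<open>w\<close> by a
    nearby direction.\<close>
  have point: "\<exists>d>0. prob {v. cmod (hdot v w) < 2 * d} < r / 4" if "norm w = 1" for w
  proof -
    have "((\<lambda>d. prob {v. cmod (hdot v w) < d}) \<longlongrightarrow> 0) (at_right 0)"
    proof (rule measure_tendsto_0)
      have "(\<Inter>n. {v. cmod (hdot v w) < inverse (real (Suc n))}) = {v. hdot v w = 0}"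
      proof (intro equalityI subsetI)
        fix v assume v: "v \<in> (\<Inter>n. {v. cmod (hdot v w) < inverse (real (Suc n))})"
        show "v \<in> {v. hdot v w = 0}"
        proof (rule ccontr)
          assume "v \<notin> {v. hdot v w = 0}"
          then have "0 < cmod (hdot v w)" by simp
          from reals_Archimedean[OF this] obtain n where "inverse (real (Suc n)) < cmod (hdot v w)" ..
          with v show False by (auto dest: spec[of _ n])
        qed
      qed auto
      moreover have "w \<noteq> 0" using that by auto
      then have "AE v in \<mu>. hdot v w \<noteq> 0" by (rule nondeg)
      then have "prob {v. hdot v w = 0} = 0"
        using measurable_sets[of "\<lambda>v. hdot v w" borel borel "{0}"]
        by (subst prob_eq_0) (auto simp: sets vimage_def)
      ultimately show "prob (\<Inter>n. {v. cmod (hdot v w) < inverse (real (Suc n))}) = 0" by simp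
    qed (auto intro: finite_measure_axioms)
    then have "\<forall>\<^sub>F d in at_right 0. prob {v. cmod (hdot v w) < d} < r / 4 \<and> 0 < d"
      by (intro eventually_conj order_tendstoD(2) eventually_at_right_less) (use r in auto)
    then obtain d where "prob {v. cmod (hdot v w) < d} < r / 4" "0 < d"
      using eventually_happens'[of "at_right (0::real)"] by fastforce
    then show ?thesis by (intro exI[of _ "d / 2"]) auto
  qed
  then obtain d where d: "\<And>w. norm w = 1 \<Longrightarrow> 0 < d w"
    "\<And>w. norm w = 1 \<Longrightarrow> prob {v. cmod (hdot v w) < 2 * d w} < r / 4"
    by metis
  have compact: "compact (sphere (0 :: cvec) 1)" by simp
  \<comment> \<open>With radius \<open>e * d w\<close>, a change of direction alters the gain by at
    most \<open>d w\<close> whenever \<open>e * norm v\<close> is at most 1.\<close>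
  have cover: "sphere (0 :: cvec) 1 \<subseteq> (\<Union>w\<in>sphere 0 1. ball w (e * d w))"
    using d(1) e(2) by (force intro!: mult_pos_pos)
  obtain F where F: "F \<subseteq> sphere (0 :: cvec) 1" "finite F"
    "sphere (0 :: cvec) 1 \<subseteq> (\<Union>w\<in>F. ball w (e * d w))"
    by (rule compactE_image[OF compact _ cover]) auto
  have Fne: "F \<noteq> {}" using F(3) sphere_cvec_nonempty by auto
  define m where "m = Min (d ` F)"
  have m: "0 < m" unfolding m_def using F(1,2) Fne d(1) by (subst Min_gr_iff) auto
  have "\<forall>\<^sub>F x in at_right 0. x < m" by (rule order_tendstoD(2)[OF tendsto_ident_at m])
  then show "\<forall>\<^sub>F x in at_right 0. dist (small_ball \<mu> x) 0 < r"
  proof eventually_elim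
    case (elim x)
    have "prob {v. cmod (hdot v w) < x} \<le> r / 2" if w: "norm w = 1" for w
    proof -
      from F(3) w obtain w' where w': "w' \<in> F" "w \<in> ball w' (e * d w')" by auto
      then have w'1: "norm w' = 1" using F(1) by auto
      have "m \<le> d w'" unfolding m_def using F(2) w' by simp
      have "{v. cmod (hdot v w) < x} \<subseteq> {v. cmod (hdot v w') < 2 * d w'} \<union> {v. 1 < e * norm v}"
      proof (intro subsetI UnCI CollectI)
        fix v assume v: "v \<in> {v. cmod (hdot v w) < x}" and "v \<notin> {v. 1 < e * norm v}"
        then have nv: "e * norm v \<le> 1" by simp
        have "norm v * norm (w' - w) \<le> norm v * (e * d w')"
          using w'(2) by (intro mult_left_mono) (auto simp: dist_norm)
        also have "\<dots> \<le> 1 * d w'"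
          using mult_right_mono[OF nv less_imp_le[OF d(1)[OF w'1]]] by (simp add: mult_ac)
        finally have "cmod (hdot v (w' - w)) \<le> d w'" using norm_hdot_le[of v "w' - w"] by simp
        moreover have "cmod (hdot v w') \<le> cmod (hdot v w) + cmod (hdot v (w' - w))"
          using norm_triangle_ineq[of "hdot v w" "hdot v (w' - w)"] by (simp add: hdot_diff)
        ultimately show "cmod (hdot v w') < 2 * d w'" using v elim \<open>m \<le> d w'\<close> by simp
      qed
      moreover have "{v :: cvec. 1 < e * norm v} \<in> sets \<mu>"
        using open_Collect_less[of "\<lambda>_. 1" "\<lambda>v :: cvec. e * norm v"] by (auto simp: sets intro!: continuous_intros)
      ultimately have "prob {v. cmod (hdot v w) < x}
          \<le> prob {v. cmod (hdot v w') < 2 * d w'} + prob {v. 1 < e * norm v}"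
        by (intro order_trans[OF finite_measure_mono measure_Un_le]) auto
      with d(2)[OF w'1] e show ?thesis by simp
    qed
    then have "small_ball \<mu> x \<le> r / 2"
      unfolding small_ball_def by (intro cSUP_least sphere_cvec_nonempty) auto
    moreover have "0 \<le> small_ball \<mu> x"
      by (rule small_ball_nonneg) (rule assms(1))
    ultimately show ?case using r by simp
  qed
qed

text \<open>Independence turns the joint law into a product. For each fixed value of
  \<open>g\<close> the precoder is a fixed unit vector, so the inner measure is bounded by
  \<open>small_ball\<close>, and Fubini concludes.\<close>

lemma (in prob_space) prob_small_gain_le:
  assumes ind: "indep_var borel h borel g" and law: "distr M borel h = \<mu>"
  shows "prob {\<omega> \<in> space M. cmod (hdot (h \<omega>) (perp (g \<omega>))) < \<delta>} \<le> small_ball \<mu> \<delta>"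
proof -
  have [measurable]: "h \<in> borel_measurable M" "g \<in> borel_measurable M"
    using ind indep_var_rv1 indep_var_rv2 by blast+
  define \<nu> where "\<nu> = distr M borel g"
  have pair: "\<mu> \<Otimes>\<^sub>M \<nu> = distr M (borel \<Otimes>\<^sub>M borel) (\<lambda>x. (h x, g x))"
    using ind unfolding indep_var_distribution_eq law \<nu>_def by simp
  interpret mu: prob_space \<mu> unfolding law[symmetric] by (rule prob_space_distr) simp
  interpret nu: prob_space \<nu> unfolding \<nu>_def by (rule prob_space_distr) simp
  interpret pair_prob_space \<mu> \<nu> ..
  have sets [measurable_cong]: "sets \<mu> = sets borel" "sets \<nu> = sets borel"
    by (auto simp: law[symmetric] \<nu>_def)
  have sp: "space \<mu> = UNIV" "space \<nu> = UNIV"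
    by (auto simp: law[symmetric] \<nu>_def)
  let ?A = "{p \<in> space (\<mu> \<Otimes>\<^sub>M \<nu>). cmod (hdot (fst p) (perp (snd p))) < \<delta>}"
  have A: "?A \<in> sets (\<mu> \<Otimes>\<^sub>M \<nu>)" by measurable
  have "emeasure (\<mu> \<Otimes>\<^sub>M \<nu>) ?A = emeasure M {\<omega> \<in> space M. cmod (hdot (h \<omega>) (perp (g \<omega>))) < \<delta>}"
    using A unfolding pair by (simp add: emeasure_distr space_pair_measure sp vimage_def Int_def conj_commute)
  moreover have "emeasure (\<mu> \<Otimes>\<^sub>M \<nu>) ?A = (\<integral>\<^sup>+w. emeasure \<mu> ((\<lambda>v. (v, w)) -` ?A) \<partial>\<nu>)"
    by (rule emeasure_pair_measure_alt2[OF A])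
  moreover have "\<dots> \<le> (\<integral>\<^sup>+w. ennreal (small_ball \<mu> \<delta>) \<partial>\<nu>)"
  proof (intro nn_integral_mono)
    fix w
    have "(\<lambda>v. (v, w)) -` ?A = {v. cmod (hdot v (perp w)) < \<delta>}"
      by (auto simp: space_pair_measure sp)
    then show "emeasure \<mu> ((\<lambda>v. (v, w)) -` ?A) \<le> ennreal (small_ball \<mu> \<delta>)"
      unfolding mu.emeasure_eq_measure
      by (intro ennreal_leI) (simp only: small_ball_ge[OF mu.prob_space_axioms norm_perp])
  qed
  moreover have "0 \<le> small_ball \<mu> \<delta>"
    by (rule small_ball_nonneg) (rule mu.prob_space_axioms)
  ultimately show ?thesis by (simp add: measure_def enn2real_leI nu.emeasure_space_1)
qed

subsection \<open>Bad channels and bad noise\<close>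

definition blk_channel :: "nat \<Rightarrow> cvec \<times> cvec \<times> cvec \<times> cvec \<Rightarrow> cvec" where
  "blk_channel j y = (if j = 0 then fst y else fst (snd y))"

definition blk_estimate :: "nat \<Rightarrow> cvec \<times> cvec \<times> cvec \<times> cvec \<Rightarrow> cvec" where
  "blk_estimate j y = (if j = 0 then fst (snd (snd y)) else snd (snd (snd y)))"

lemma borel_measurable_blk [measurable]:
  "blk_channel j \<in> borel_measurable borel" "blk_estimate j \<in> borel_measurable borel"
  unfolding blk_channel_def blk_estimate_def
  by (cases "j = 0"; simp; intro borel_measurable_continuous_onI continuous_intros)+

text \<open>Here \<open>h\<close> and \<open>e\<close> are a user's channel and its estimate, and
  \<open>e'\<close> is the estimate of the other user's channel. The user's own private symbol
  travels along \<open>perp e'\<close>, the interfering one along \<open>perp e\<close>;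
  \<open>l\<close> is the mean leakage of the latter.\<close>

definition favourable :: "real \<Rightarrow> real \<Rightarrow> cvec \<Rightarrow> cvec \<Rightarrow> cvec \<Rightarrow> bool" where
  "favourable t l h e e' \<longleftrightarrow> norm h \<le> t \<and> 1 / t \<le> cmod (hdot h (axis 1 1)) \<and>
     1 / t \<le> cmod (hdot h (perp e')) \<and> cmod (hdot h (perp e)) \<le> t * sqrt l"

context alternating_csit
begin

lemma blk_block:
  "j < 2 \<Longrightarrow> blk_channel j (block P (u, k) \<omega>) = H u P (2 * k + j) \<omega>"
  "j < 2 \<Longrightarrow> blk_estimate j (block P (u, k) \<omega>) = He u P (2 * k + j) \<omega>"
  by (auto simp: blk_channel_def blk_estimate_def block_def less_2_cases_iff)

definition channel_good :: "user \<Rightarrow> real \<Rightarrow> real \<Rightarrow> nat \<Rightarrow> 'w \<Rightarrow> bool" where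
  "channel_good u P t k \<omega> \<longleftrightarrow> (\<forall>j<2. favourable t (leak u P j)
     (H u P (2 * k + j) \<omega>) (He u P (2 * k + j) \<omega>) (He (other u) P (2 * k + j) \<omega>))"

definition noise_good :: "user \<Rightarrow> real \<Rightarrow> nat \<Rightarrow> 'w \<Rightarrow> bool" where
  "noise_good u t k \<omega> \<longleftrightarrow> (\<forall>j<2. cmod (Z u (2 * k + j) \<omega>) \<le> t)"

text \<open>A union bound over the two subbands of a pair: large norm, small gain of the common
  precoder, small gain of the private precoder, and excessive leakage. Using \<open>1 / t\<close>
  throughout lets limits at \<open>at_right 0\<close> be substituted.\<close>

definition channel_fail :: "real \<Rightarrow> real" where
  "channel_fail t = 2 * (measure \<mu> {v. 1 < (1 / t) * norm v} + 2 * small_ball \<mu> (1 / t) + (1 / t)\<^sup>2)"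

definition noise_fail :: "real \<Rightarrow> real" where
  "noise_fail t = 2 * measure (distr M borel (Z User1 0)) {z. 1 < (1 / t) * cmod z}"

lemma noise_measurable [measurable]: "Z u i \<in> borel_measurable M"
  using noise_distributed by (auto simp: distributed_def)

lemma sets_law: "sets \<mu> = sets borel"
  using channel_law[of 1 User1 0] by auto

lemma prob_space_law: "prob_space \<mu>"
  unfolding channel_law[of 1 User1 0, symmetric, OF zero_less_one]
  by (rule prob_space_distr) (rule channel_measurable, simp)

lemma prob_channel:
  assumes "P > 0" "S \<in> sets borel"
  shows "prob {\<omega> \<in> space M. H u P i \<omega> \<in> S} = measure \<mu> S"
  using measure_distr[OF channel_measurable[OF assms(1)] assms(2), of u i] channel_law[OF assms(1), of u i]
  by (simp add: vimage_def Int_def conj_commute)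

lemma channel_square_integrable:
  assumes "P > 0" shows "integrable M (\<lambda>\<omega>. (norm (H u P i \<omega>))\<^sup>2)"
proof -
  have "integrable (distr M borel (H u P i)) (\<lambda>v. (norm v)\<^sup>2)"
    using law_square_integrable channel_law[OF assms] by simp
  then show ?thesis using channel_measurable[OF assms] by (subst (asm) integrable_distr_eq) auto
qed

text \<open>The blocks of the two users are independent, hence so are the channel of
  \<open>u\<close> and the precoder of its private symbol.\<close>

lemma channel_indep_estimate:
  assumes "P > 0" "j < 2"
  shows "indep_var borel (H u P (2 * k + j)) borel (He (other u) P (2 * k + j))"
proof -
  have "indep_var (Pi\<^sub>M {(u, k)} (\<lambda>_. borel)) (\<lambda>\<omega>. restrict (\<lambda>q. block P q \<omega>) {(u, k)})
     (Pi\<^sub>M {(other u, k)} (\<lambda>_. borel)) (\<lambda>\<omega>. restrict (\<lambda>q. block P q \<omega>) {(other u, k)})"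
    by (rule indep_var_restrict[OF blocks_indep[OF assms(1)]]) auto
  from indep_var_compose[OF this, of "\<lambda>y. blk_channel j (y (u, k))" borel
      "\<lambda>y. blk_estimate j (y (other u, k))" borel]
  have "indep_var borel ((\<lambda>y. blk_channel j (y (u, k))) \<circ> (\<lambda>\<omega>. restrict (\<lambda>q. block P q \<omega>) {(u, k)}))
     borel ((\<lambda>y. blk_estimate j (y (other u, k))) \<circ> (\<lambda>\<omega>. restrict (\<lambda>q. block P q \<omega>) {(other u, k)}))"
    by (auto intro!: measurable_compose[OF measurable_component_singleton] borel_measurable_blk)
  then show ?thesis by (simp add: comp_def blk_block assms(2))
qed

lemma leak_even_add: "P > 0 \<Longrightarrow> leak u P (2 * k + j) = leak u P j"
  by (rule leak_eq) auto

text \<open>Chebyshev's inequality in second-moment form; the square is integrable because a unit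
  precoder gives at most the norm of the channel.\<close>

lemma prob_leak_exceeds:
  assumes "P > 0" "0 < leak u P i" "0 < t"
  shows "prob {\<omega> \<in> space M. t * sqrt (leak u P i) < cmod (hdot (H u P i \<omega>) (perp (He u P i \<omega>)))} \<le> (1 / t)\<^sup>2"
proof -
  have [measurable]: "H u P i \<in> borel_measurable M" "He u P i \<in> borel_measurable M"
    using assms channel_measurable estimate_measurable by auto
  define f where "f \<omega> = hdot (H u P i \<omega>) (perp (He u P i \<omega>))" for \<omega>
  have [measurable]: "f \<in> borel_measurable M" unfolding f_def by measurable
  have "integrable M (\<lambda>\<omega>. (cmod (f \<omega>))\<^sup>2)"
  proof (rule Bochner_Integration.integrable_bound[OF channel_square_integrable[OF assms(1)]])
    show "AE \<omega> in M. norm ((cmod (f \<omega>))\<^sup>2) \<le> norm ((norm (H u P i \<omega>))\<^sup>2)"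
    proof (intro AE_I2)
      fix \<omega>
      have "cmod (f \<omega>) \<le> norm (H u P i \<omega>)"
        using norm_hdot_le[of "H u P i \<omega>" "perp (He u P i \<omega>)"] by (simp add: f_def norm_perp)
      then show "norm ((cmod (f \<omega>))\<^sup>2) \<le> norm ((norm (H u P i \<omega>))\<^sup>2)" by (simp add: power_mono)
    qed
  qed measurable
  then have "prob {\<omega> \<in> space M. \<bar>cmod (f \<omega>)\<bar> \<ge> t * sqrt (leak u P i)}
      \<le> expectation (\<lambda>\<omega>. (cmod (f \<omega>))\<^sup>2) / (t * sqrt (leak u P i))\<^sup>2"
    by (intro second_moment_method) (use assms in auto)
  also have "expectation (\<lambda>\<omega>. (cmod (f \<omega>))\<^sup>2) = leak u P i" by (simp add: leak_def f_def)
  also have "leak u P i / (t * sqrt (leak u P i))\<^sup>2 = (1 / t)\<^sup>2"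
    using assms by (simp add: power_mult_distrib power_divide)
  finally show ?thesis
    by (rule order_trans[rotated]) (auto intro!: finite_measure_mono simp: f_def)
qed

lemma prob_not_favourable:
  assumes "P > 0" "0 < leak u P j" "0 < t" "j < 2"
  shows "prob {\<omega> \<in> space M. \<not> favourable t (leak u P j)
     (H u P (2 * k + j) \<omega>) (He u P (2 * k + j) \<omega>) (He (other u) P (2 * k + j) \<omega>)} \<le> channel_fail t / 2"
proof -
  let ?h = "H u P (2 * k + j)" and ?e = "He u P (2 * k + j)" and ?e' = "He (other u) P (2 * k + j)"
  have [measurable]: "?h \<in> borel_measurable M" "?e \<in> borel_measurable M" "?e' \<in> borel_measurable M"
    using assms channel_measurable estimate_measurable by auto
  let ?A1 = "{\<omega> \<in> space M. ?h \<omega> \<in> {v. 1 < (1 / t) * norm v}}"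
  let ?A2 = "{\<omega> \<in> space M. ?h \<omega> \<in> {v. cmod (hdot v (axis 1 1)) < 1 / t}}"
  let ?A3 = "{\<omega> \<in> space M. cmod (hdot (?h \<omega>) (perp (?e' \<omega>))) < 1 / t}"
  let ?A4 = "{\<omega> \<in> space M. t * sqrt (leak u P j) < cmod (hdot (?h \<omega>) (perp (?e \<omega>)))}"
  have m: "{v :: cvec. 1 < (1 / t) * norm v} \<in> sets borel"
    "{v :: cvec. cmod (hdot v (axis 1 1)) < 1 / t} \<in> sets borel" by measurable
  have "prob {\<omega> \<in> space M. \<not> favourable t (leak u P j) (?h \<omega>) (?e \<omega>) (?e' \<omega>)}
      \<le> prob (?A1 \<union> ?A2 \<union> ?A3 \<union> ?A4)"
  proof (rule finite_measure_mono)
    show "?A1 \<union> ?A2 \<union> ?A3 \<union> ?A4 \<in> events" by measurable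
  qed (use \<open>0 < t\<close> in \<open>auto simp: favourable_def not_le field_simps\<close>)
  also have "\<dots> \<le> prob ?A1 + prob ?A2 + prob ?A3 + prob ?A4"
    by (intro order_trans[OF measure_Un_le] add_mono order_refl) measurable
  also have "\<dots> \<le> measure \<mu> {v. 1 < (1 / t) * norm v} + small_ball \<mu> (1 / t) + small_ball \<mu> (1 / t) + (1 / t)\<^sup>2"
  proof (intro add_mono)
    show "prob ?A1 \<le> measure \<mu> {v. 1 < (1 / t) * norm v}"
      by (rule eq_refl, rule prob_channel[OF assms(1) m(1)])
    show "prob ?A2 \<le> small_ball \<mu> (1 / t)"
      using small_ball_ge[OF prob_space_law, of "axis 1 1" "1 / t"] 
      unfolding prob_channel[OF assms(1) m(2)] by (simp add: norm_axis_1)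
    show "prob ?A3 \<le> small_ball \<mu> (1 / t)"
      by (rule prob_small_gain_le[OF channel_indep_estimate[OF assms(1,4)] channel_law[OF assms(1)]])
    show "prob ?A4 \<le> (1 / t)\<^sup>2"
      using prob_leak_exceeds[OF assms(1), of u "2 * k + j" t] assms(1,2,3) by (simp add: leak_even_add)
  qed
  finally show ?thesis by (simp add: channel_fail_def)
qed

text \<open>Whether pair \<open>k\<close> is bad for \<open>u\<close> depends on the blocks of both
  users in that pair, since both precoders matter. Grouping the independent blocks by pairs gives
  disjoint groups.\<close>

lemma channel_bad_count_tail:
  assumes "P > 0" "\<And>i. 0 < leak u P i" "0 < t" and \<eta>: "channel_fail t \<le> \<eta>" "0 < \<eta>" "0 < L"
  shows "prob {\<omega> \<in> space M. 2 * \<eta> * real L \<le> real (card {k\<in>{..<L}. \<not> channel_good u P t k \<omega>})}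
    \<le> exp (- 2 * \<eta>\<^sup>2 * real L)"
proof -
  define K :: "nat \<Rightarrow> (user \<times> nat) set" where "K k = UNIV \<times> {k}" for k
  define A where "A k = {y \<in> space (Pi\<^sub>M (K k) (\<lambda>_. borel)). \<not> (\<forall>j\<in>{..<2}. favourable t (leak u P j)
     (blk_channel j (y (u, k))) (blk_estimate j (y (u, k))) (blk_estimate j (y (other u, k))))}" for k
  have Am: "A k \<in> sets (Pi\<^sub>M (K k) (\<lambda>_. borel))" for k
  proof -
    have [measurable]: "(\<lambda>y. blk_channel j (y (v, k))) \<in> borel_measurable (Pi\<^sub>M (K k) (\<lambda>_. borel))"
      "(\<lambda>y. blk_estimate j (y (v, k))) \<in> borel_measurable (Pi\<^sub>M (K k) (\<lambda>_. borel))" for j v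
      by (auto intro!: measurable_compose[OF measurable_component_singleton] borel_measurable_blk
          simp: K_def)
    show ?thesis unfolding A_def favourable_def by measurable
  qed
  have iff: "restrict (\<lambda>q. block P q \<omega>) (K k) \<in> A k \<longleftrightarrow> \<not> channel_good u P t k \<omega>" for k \<omega>
    by (auto simp: A_def K_def channel_good_def space_PiM blk_block)
  have "prob {\<omega> \<in> space M. restrict (\<lambda>q. block P q \<omega>) (K k) \<in> A k} \<le> \<eta>" for k
  proof -
    have [measurable]: "H v P i \<in> borel_measurable M" "He v P i \<in> borel_measurable M" for v i
      using assms channel_measurable estimate_measurable by auto
    let ?B = "\<lambda>j. {\<omega> \<in> space M. \<not> favourable t (leak u P j)
     (H u P (2 * k + j) \<omega>) (He u P (2 * k + j) \<omega>) (He (other u) P (2 * k + j) \<omega>)}"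
    have B: "?B j \<in> events" for j unfolding favourable_def by measurable
    have "{\<omega> \<in> space M. restrict (\<lambda>q. block P q \<omega>) (K k) \<in> A k} = ?B 0 \<union> ?B 1"
      unfolding iff channel_good_def by (auto simp: less_2_cases_iff)
    then have "prob {\<omega> \<in> space M. restrict (\<lambda>q. block P q \<omega>) (K k) \<in> A k} \<le> prob (?B 0) + prob (?B 1)"
      using measure_Un_le[of "?B 0" M "?B 1"] B[of 0] B[of 1] by simp
    also have "\<dots> \<le> channel_fail t / 2 + channel_fail t / 2"
      by (intro add_mono prob_not_favourable) (use assms in auto)
    finally show ?thesis using \<eta> by simp
  qed
  moreover have "disjoint_family K" by (auto simp: disjoint_family_on_def K_def)
  ultimately show ?thesis
    using indep_groups_count_tail[where K = K and A = A, OF blocks_indep[OF assms(1)] _ Am _ \<eta>(2,3)] unfolding iff by blast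
qed

lemma distr_noise: "distr M borel (Z u i) = distr M borel (Z User1 0)"
  using noise_distributed unfolding distributed_def by (metis distr_cong sets_lborel)

lemma noise_bad_count_tail:
  assumes \<eta>: "noise_fail t \<le> \<eta>" "0 < \<eta>" "0 < L" and "0 < t"
  shows "prob {\<omega> \<in> space M. 2 * \<eta> * real L \<le> real (card {k\<in>{..<L}. \<not> noise_good u t k \<omega>})}
    \<le> exp (- 2 * \<eta>\<^sup>2 * real L)"
proof -
  define K :: "nat \<Rightarrow> (user \<times> nat) set" where "K k = {u} \<times> {2 * k, 2 * k + 1}" for k
  define A where "A k = {y \<in> space (Pi\<^sub>M (K k) (\<lambda>_. borel)). \<not> (cmod (y (u, 2 * k)) \<le> t \<and>
    cmod (y (u, 2 * k + 1)) \<le> t)}" for k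
  have Am: "A k \<in> sets (Pi\<^sub>M (K k) (\<lambda>_. borel))" for k
  proof -
    have [measurable]: "(\<lambda>y. y (u, 2 * k)) \<in> borel_measurable (Pi\<^sub>M (K k) (\<lambda>_. borel))"
       "(\<lambda>y. y (u, 2 * k + 1)) \<in> borel_measurable (Pi\<^sub>M (K k) (\<lambda>_. borel))"
      by (auto intro!: measurable_component_singleton simp: K_def)
    show ?thesis unfolding A_def by measurable
  qed
  have iff: "restrict (\<lambda>q. (case q of (u, i) \<Rightarrow> Z u i) \<omega>) (K k) \<in> A k \<longleftrightarrow> \<not> noise_good u t k \<omega>" for k \<omega>
    by (auto simp: A_def K_def noise_good_def space_PiM less_2_cases_iff)
  have single: "prob {\<omega> \<in> space M. \<not> cmod (Z u i \<omega>) \<le> t} = noise_fail t / 2" for i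
  proof -
    have "{z. 1 < (1 / t) * cmod z} \<in> sets borel" by measurable
    then have "measure (distr M borel (Z u i)) {z. 1 < (1 / t) * cmod z} =
      prob {\<omega> \<in> space M. \<not> cmod (Z u i \<omega>) \<le> t}"
      using \<open>0 < t\<close> by (subst measure_distr) (auto intro!: arg_cong[where f = prob] simp: field_simps)
    then show ?thesis by (simp add: noise_fail_def distr_noise[of u i])
  qed
  have "prob {\<omega> \<in> space M. restrict (\<lambda>q. (case q of (u, i) \<Rightarrow> Z u i) \<omega>) (K k) \<in> A k} \<le> \<eta>" for k
  proof -
    let ?B = "\<lambda>j. {\<omega> \<in> space M. \<not> cmod (Z u (2 * k + j) \<omega>) \<le> t}"
    have B: "?B j \<in> events" for j by measurable
    have "{\<omega> \<in> space M. restrict (\<lambda>q. (case q of (u, i) \<Rightarrow> Z u i) \<omega>) (K k) \<in> A k} = ?B 0 \<union> ?B 1"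
      unfolding iff noise_good_def by (auto simp: less_2_cases_iff)
    then have "prob {\<omega> \<in> space M. restrict (\<lambda>q. (case q of (u, i) \<Rightarrow> Z u i) \<omega>) (K k) \<in> A k} \<le> prob (?B 0) + prob (?B 1)"
      using measure_Un_le[of "?B 0" M "?B 1"] B[of 0] B[of 1] by simp
    then show ?thesis using \<eta> single[of "2 * k"] single[of "2 * k + 1"] by simp
  qed
  moreover have "disjoint_family K" by (auto simp: disjoint_family_on_def K_def)
  ultimately show ?thesis
    using indep_groups_count_tail[where K = K and A = A, OF noise_indep _ Am _ \<eta>(2,3)] unfolding iff by blast
qed

lemma fail_tendsto_0:
  "((\<lambda>t. channel_fail t) \<longlongrightarrow> 0) at_top" "((\<lambda>t. noise_fail t) \<longlongrightarrow> 0) at_top"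
proof -
  have inv: "filterlim (\<lambda>t :: real. 1 / t) (at_right 0) at_top"
    using filterlim_inverse_at_right_top by (simp add: inverse_eq_divide)
  interpret mu: prob_space \<mu> by (rule prob_space_law)
  have "((\<lambda>e. 2 * (measure \<mu> {v. 1 < e * norm v} + 2 * small_ball \<mu> e + e\<^sup>2)) \<longlongrightarrow> 2 * (0 + 2 * 0 + 0\<^sup>2)) (at_right 0)"
    by (intro tendsto_intros measure_norm_tail_tendsto_0 small_ball_tendsto_0 prob_space_law sets_law
        mu.finite_measure_axioms law_nondegenerate)
  from filterlim_compose[OF this inv]
  show "((\<lambda>t. channel_fail t) \<longlongrightarrow> 0) at_top" by (simp add: channel_fail_def)
  interpret Z: prob_space "distr M borel (Z User1 0)" by (rule prob_space_distr) simp
  have "((\<lambda>e. 2 * measure (distr M borel (Z User1 0)) {v. 1 < e * norm v}) \<longlongrightarrow> 2 * 0) (at_right 0)"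
    by (intro tendsto_intros measure_norm_tail_tendsto_0 Z.finite_measure_axioms) simp
  from filterlim_compose[OF this inv]
  show "((\<lambda>t. noise_fail t) \<longlongrightarrow> 0) at_top" by (simp add: noise_fail_def)
qed

end

subsection \<open>Coding over a fixed SNR\<close>

lemma borel_measurable_card_less [measurable]:
  fixes F :: "nat \<Rightarrow> 'a \<Rightarrow> bool"
  assumes "\<And>k. k < L \<Longrightarrow> Measurable.pred N (F k)"
  shows "(\<lambda>x. real (card {k\<in>{..<L}. F k x})) \<in> borel_measurable N"
proof -
  have "(\<lambda>x. real (card {k\<in>{..<L}. F k x})) = (\<lambda>x. \<Sum>k<L. if F k x then 1 else 0)"
    by (subst sum.If_cases) (auto intro!: ext arg_cong[where f = card])
  moreover have "(\<lambda>x. \<Sum>k<L. if F k x then 1 else (0::real)) \<in> borel_measurable N"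
  proof (rule borel_measurable_sum)
    fix k assume "k \<in> {..<L}"
    then have [measurable]: "Measurable.pred N (F k)" using assms by simp
    show "(\<lambda>x. if F k x then 1 else (0::real)) \<in> borel_measurable N" by measurable
  qed
  ultimately show ?thesis by simp
qed

lemma msg_avg_bounds:
  assumes "1 \<le> K1" "1 \<le> K2" and "\<And>m. m \<in> {..<K1} \<times> {..<K2} \<Longrightarrow> f m \<in> {a..b}"
  shows "msg_avg K1 K2 f \<in> {a..b}"
proof -
  have "real K1 * real K2 * a \<le> (\<Sum>m\<in>{..<K1} \<times> {..<K2}. f m)"
    using sum_bounded_below[of "{..<K1} \<times> {..<K2}" a f] assms(3) by simp
  moreover have "(\<Sum>m\<in>{..<K1} \<times> {..<K2}. f m) \<le> real K1 * real K2 * b"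
    using sum_bounded_above[of "{..<K1} \<times> {..<K2}" f b] assms(3) by simp
  moreover have "0 < real K1 * real K2" using assms by simp
  ultimately show ?thesis
    unfolding msg_avg_def by (simp add: pos_le_divide_eq pos_divide_le_eq mult.commute)
qed

locale superposition_csit = alternating_csit M H He Z \<mu> \<alpha> \<beta> + superposition t A B Off nx nc a Q X C W
  for M :: "'w measure" and H He Z \<mu> \<alpha> \<beta> t A B Off nx nc a Q X C W +
  fixes P :: real
  assumes P_pos: "0 < P" and leak_pos: "\<And>u i. 0 < leak u P i"
    and a_leak: "\<And>u j. real (a (reported u j)) * sqrt (leak u P j) \<le> 1 / t ^ 3"
begin

text \<open>The tolerance \<open>3 * t\<close> is \<open>t\<close> for the noise plus
  \<open>2 * t\<close> for the interference, which the test leaves out of the expected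
  signal.\<close>

definition consistent :: "user \<Rightarrow> nat \<Rightarrow> nat \<times> nat \<Rightarrow>
    (nat \<Rightarrow> complex) \<times> (nat \<Rightarrow> cvec) \<times> (user \<times> nat \<Rightarrow> cvec) \<Rightarrow> bool" where
  "consistent u k b = (\<lambda>(y, h, c). \<forall>j\<in>{..<2}. cmod (y (2 * k + j)
     - hdot (h (2 * k + j)) (desired u b j (\<lambda>v. c (v, 2 * k + j)))) \<le> 3 * t)"

text \<open>The search runs over symbol pairs, as the common symbols depend on both users, but only
  the own component is returned. If no pair is consistent, \<open>LEAST\<close> is some unspecified
  number, at worst a wrong symbol for the outer code to correct.\<close>

definition detect :: "user \<Rightarrow> nat \<Rightarrow> (nat \<Rightarrow> complex) \<times> (nat \<Rightarrow> cvec) \<times> (user \<times> nat \<Rightarrow> cvec) \<Rightarrow> nat" where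
  "detect u k x = (LEAST m. \<exists>b\<in>{..<Q User1} \<times> {..<Q User2}. m = msg u b \<and> consistent u k b x)"

text \<open>Amplitude \<open>t ^ 3\<close>, a symbol of modulus at most twice the grid size and
  leakage at most \<open>t * sqrt (leak u P j)\<close> multiply to at most \<open>2 * t\<close> by
  \<open>a_leak\<close>.\<close>

lemma interference_le:
  assumes "channel_good u P t k \<omega>" "b \<in> {..<Q User1} \<times> {..<Q User2}" "j < 2"
  shows "cmod (hdot (H u P (2 * k + j) \<omega>) (own_part (other u) b j (\<lambda>v. He v P (2 * k + j) \<omega>))) \<le> 2 * t"
proof -
  let ?W = "W (other u) (msg (other u) b) j"
  let ?p = "hdot (H u P (2 * k + j) \<omega>) (perp (He u P (2 * k + j) \<omega>))"
  have "cmod ?W \<le> 2 * real (a (reported u j))"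
    using gauss_grid_norm_le[OF W_grid[OF msg_less[OF assms(2), of "other u"] assms(3)]] by simp
  moreover have "cmod ?p \<le> t * sqrt (leak u P j)"
    using assms(1,3) by (auto simp: channel_good_def favourable_def)
  ultimately have "cmod ?W * cmod ?p \<le> 2 * real (a (reported u j)) * (t * sqrt (leak u P j))"
    by (rule mult_mono) auto
  then have "t ^ 3 * (cmod ?W * cmod ?p) \<le> t ^ 3 * (2 * real (a (reported u j)) * (t * sqrt (leak u P j)))"
    using t_ge by (intro mult_left_mono) auto
  also have "\<dots> = 2 * t * (t ^ 3 * (real (a (reported u j)) * sqrt (leak u P j)))"
    by (simp add: mult_ac)
  also have "\<dots> \<le> 2 * t * (t ^ 3 * (1 / t ^ 3))"
    using a_leak[of u j] t_ge by (intro mult_left_mono) auto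
  also have "\<dots> = 2 * t" using t_ge by simp
  finally show ?thesis
    using t_ge by (simp add: own_part_def hdot_scale norm_mult norm_power mult_ac)
qed

text \<open>The true pair passes the test. Any other passing pair lies within \<open>6 * t\<close>
  of it after reception, so \<open>detection_unique\<close> gives it the same own component, even if
  the other component differs.\<close>

lemma detect_correct:
  assumes good: "channel_good u P t k \<omega>" "noise_good u t k \<omega>"
    and b: "b \<in> {..<Q User1} \<times> {..<Q User2}"
    and x: "\<And>j. j < 2 \<Longrightarrow> y (2 * k + j) =
        hdot (H u P (2 * k + j) \<omega>) (signal b j (\<lambda>v. He v P (2 * k + j) \<omega>)) + Z u (2 * k + j) \<omega>"
      "\<And>j. j < 2 \<Longrightarrow> h (2 * k + j) = H u P (2 * k + j) \<omega>"
      "\<And>j v. j < 2 \<Longrightarrow> c (v, 2 * k + j) = He v P (2 * k + j) \<omega>"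
  shows "detect u k (y, h, c) = msg u b"
proof -
  define e where "e j = (\<lambda>v. He v P (2 * k + j) \<omega>)" for j
  define g where "g j = H u P (2 * k + j) \<omega>" for j
  have ce: "(\<lambda>v. c (v, 2 * k + j)) = e j" if "j < 2" for j
    using x(3)[OF that] by (simp add: e_def)
  have cons: "consistent u k b' (y, h, c) \<longleftrightarrow>
      (\<forall>j<2. cmod (y (2 * k + j) - hdot (g j) (desired u b' j (e j))) \<le> 3 * t)" for b'
    unfolding consistent_def by (auto simp: ce x(2) g_def)
  have ok: "consistent u k b (y, h, c)"
    unfolding cons
  proof (intro allI impI)
    fix j :: nat assume j: "j < 2"
    have "cmod (Z u (2 * k + j) \<omega>) \<le> t" using good(2) j by (auto simp: noise_good_def)
    moreover have "cmod (hdot (g j) (own_part (other u) b j (e j))) \<le> 2 * t"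
      using interference_le[OF good(1) b j] by (simp add: g_def e_def)
    moreover have "y (2 * k + j) - hdot (g j) (desired u b j (e j)) =
        hdot (g j) (own_part (other u) b j (e j)) + Z u (2 * k + j) \<omega>"
      using x(1)[OF j] by (simp add: signal_eq[of _ _ _ u] hdot_add g_def e_def)
    ultimately show "cmod (y (2 * k + j) - hdot (g j) (desired u b j (e j))) \<le> 3 * t"
      using norm_triangle_ineq[of "hdot (g j) (own_part (other u) b j (e j))" "Z u (2 * k + j) \<omega>"] by simp
  qed
  have unique: "msg u b' = msg u b"
    if b': "b' \<in> {..<Q User1} \<times> {..<Q User2}" "consistent u k b' (y, h, c)" for b'
  proof (rule detection_unique[OF b'(1) b, of g "\<lambda>j. e j"])
    fix j :: nat assume j: "j < 2"
    show "norm (g j) \<le> t" "1 / t \<le> cmod (hdot (g j) (axis 1 1))"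
      "1 / t \<le> cmod (hdot (g j) (perp (e j (other u))))"
      using good(1) j by (auto simp: channel_good_def favourable_def g_def e_def)
    show "cmod (hdot (g j) (desired u b' j (e j)) - hdot (g j) (desired u b j (e j))) \<le> 6 * t"
    proof -
      have "cmod (y (2 * k + j) - hdot (g j) (desired u b j (e j))) \<le> 3 * t"
        "cmod (y (2 * k + j) - hdot (g j) (desired u b' j (e j))) \<le> 3 * t"
        using ok b'(2) j unfolding cons by auto
      then show ?thesis
        using norm_triangle_ineq4[of "y (2 * k + j) - hdot (g j) (desired u b j (e j))"
          "y (2 * k + j) - hdot (g j) (desired u b' j (e j))"] by (simp add: norm_minus_commute)
    qed
  qed
  show ?thesis
    unfolding detect_def
  proof (rule Least_equality)
    show "\<exists>b'\<in>{..<Q User1} \<times> {..<Q User2}. msg u b = msg u b' \<and> consistent u k b' (y, h, c)"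
      using b ok by blast
    show "msg u b \<le> m" if "\<exists>b'\<in>{..<Q User1} \<times> {..<Q User2}. m = msg u b' \<and> consistent u k b' (y, h, c)" for m
      using that unique by force
  qed
qed

lemma measurable_detect:
  assumes "k < L"
  shows "detect u k \<in> Pi\<^sub>M {..<L * 2} (\<lambda>_. borel) \<Otimes>\<^sub>M Pi\<^sub>M {..<L * 2} (\<lambda>_. borel)
    \<Otimes>\<^sub>M Pi\<^sub>M (UNIV \<times> {..<L * 2}) (\<lambda>_. borel) \<rightarrow>\<^sub>M count_space UNIV" (is "_ \<in> ?N \<rightarrow>\<^sub>M _")
proof -
  have c1: "(\<lambda>x. fst x (2 * k + j)) \<in> borel_measurable ?N" if "j \<in> {..<2}" for j
    using assms that
    by (intro measurable_compose[OF measurable_fst measurable_component_singleton]) auto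
  have c2: "(\<lambda>x. fst (snd x) (2 * k + j)) \<in> borel_measurable ?N" if "j \<in> {..<2}" for j
    using assms that
    by (intro measurable_compose[OF measurable_compose[OF measurable_snd measurable_fst] measurable_component_singleton]) auto
  have c3: "(\<lambda>x. snd (snd x) (v, 2 * k + j)) \<in> borel_measurable ?N" if "j \<in> {..<2}" for v j
    using assms that
    by (intro measurable_compose[OF measurable_compose[OF measurable_snd measurable_snd] measurable_component_singleton]) auto
  have "Measurable.pred ?N (consistent u k b)" for b
    unfolding consistent_def split_beta'
  proof (rule pred_intros_finite)
    fix j :: nat assume j: "j \<in> {..<2}"
    note [measurable] = c1[OF j] c2[OF j] c3[OF j]
    show "Measurable.pred ?N (\<lambda>x. cmod (fst x (2 * k + j) - hdot (fst (snd x) (2 * k + j))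
       (desired u b j (\<lambda>v. snd (snd x) (v, 2 * k + j)))) \<le> 3 * t)"
      unfolding desired_def common_def own_part_def by measurable
  qed simp
  then have "Measurable.pred ?N (\<lambda>x. \<exists>b\<in>{..<Q User1} \<times> {..<Q User2}. m = msg u b \<and> consistent u k b x)" for m
    by (intro pred_intros_finite pred_intros_logic) auto
  then show ?thesis unfolding detect_def by (rule measurable_Least)
qed

text \<open>Outside two events of probability at most
  \<open>exp (- 2 * \<eta>\<^sup>2 * real L)\<close> each, fewer than
  \<open>2 * \<eta> * real L\<close> pairs have a bad channel and equally few have bad noise. Thus
  at most half of \<open>D\<close> inner decisions are wrong, and the distance of the outer code
  exceeds \<open>D\<close>.\<close>

lemma code_exists_superposition:
  assumes \<eta>: "channel_fail t \<le> \<eta>" "noise_fail t \<le> \<eta>" "0 < \<eta>" and L: "0 < L"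
    and D: "8 * \<eta> * real L \<le> real D"
    and gv: "\<And>u. (K u - 1) * (2 ^ L * Q u ^ D) < Q u ^ L"
    and K: "\<And>u. 1 \<le> K u" and Q: "\<And>u. 1 \<le> Q u"
    and \<epsilon>: "2 * exp (- 2 * \<eta>\<^sup>2 * real L) \<le> \<epsilon>"
  shows "code_exists P (L * 2) ((Off / 2)\<^sup>2) ((2 * Off)\<^sup>2) (K User1) (K User2) \<epsilon>"
proof -
  have [measurable]: "H v P i \<in> borel_measurable M" "He v P i \<in> borel_measurable M" for v i
    using P_pos channel_measurable estimate_measurable by auto
  have t0: "0 < t" using t_ge by simp
  have "\<exists>code :: nat \<Rightarrow> nat \<Rightarrow> nat. (\<forall>m<K u. \<forall>k<L. code m k < Q u) \<and>
    (\<forall>m<K u. \<forall>m'<K u. m \<noteq> m' \<longrightarrow> D < hamming L (code m) (code m'))" for u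
    by (rule gilbert_varshamov[OF Q gv])
  then obtain code :: "user \<Rightarrow> nat \<Rightarrow> nat \<Rightarrow> nat" where
    code: "\<And>u m k. m < K u \<Longrightarrow> k < L \<Longrightarrow> code u m k < Q u" and
    dist: "\<And>u m m'. m < K u \<Longrightarrow> m' < K u \<Longrightarrow> m \<noteq> m' \<Longrightarrow> D < hamming L (code u m) (code u m')"
    by metis
  define sym where "sym m k = (code User1 (fst m) k, code User2 (snd m) k)" for m k
  \<comment> \<open>Pair \<open>i div 2\<close> carries one letter of each outer codeword.
    Measurability is demanded for every \<open>i\<close>, so the encoder sends 0 beyond the horizon,
    where the estimates have no coordinate.\<close>
  define enc :: "nat \<times> nat \<Rightarrow> nat \<Rightarrow> (user \<times> nat \<Rightarrow> cvec) \<Rightarrow> cvec"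
    where "enc m i c = (if i < L * 2 then signal (sym m (i div 2)) (i mod 2) (\<lambda>v. c (v, i)) else 0)" for m i c
  \<comment> \<open>Bounded-distance decoding: by the triangle inequality, at most one codeword lies
    within half of \<open>D\<close> of the detected word.\<close>
  define dec where "dec u x = (LEAST m. m < K u \<and> 2 * hamming L (\<lambda>k. detect u k x) (code u m) \<le> D)" for u x
  let ?C = "Pi\<^sub>M (UNIV \<times> {..<L * 2}) (\<lambda>_. borel) :: (user \<times> nat \<Rightarrow> cvec) measure"
  let ?N = "Pi\<^sub>M {..<L * 2} (\<lambda>_. borel) \<Otimes>\<^sub>M Pi\<^sub>M {..<L * 2} (\<lambda>_. borel) \<Otimes>\<^sub>M ?C
     :: ((nat \<Rightarrow> complex) \<times> (nat \<Rightarrow> cvec) \<times> (user \<times> nat \<Rightarrow> cvec)) measure"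
  have enc_meas [measurable]: "enc m i \<in> ?C \<rightarrow>\<^sub>M borel" for m i
  proof (cases "i < L * 2")
    case True
    then have [measurable]: "(\<lambda>c. c (v, i)) \<in> ?C \<rightarrow>\<^sub>M borel" for v
      by (intro measurable_component_singleton) auto
    show ?thesis using True
      unfolding enc_def signal_def common_def own_part_def by simp
  next
    case False then show ?thesis unfolding enc_def by simp
  qed
  have dec_meas: "dec u \<in> ?N \<rightarrow>\<^sub>M count_space UNIV" for u
  proof -
    have ham: "(\<lambda>x. real (hamming L (\<lambda>k. detect u k x) (code u m))) \<in> borel_measurable ?N" for m
      unfolding hamming_def
    proof (rule borel_measurable_card_less)
      fix k assume "k < L"
      note [measurable] = measurable_detect[OF this, of u]
      show "Measurable.pred ?N (\<lambda>x. detect u k x \<noteq> code u m k)" by measurable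
    qed
    have pred: "Measurable.pred ?N (\<lambda>x. real (hamming L (\<lambda>k. detect u k x) (code u m)) \<le> real D / 2)" for m
      unfolding pred_def by (rule borel_measurable_le[OF ham borel_measurable_const])
    have pred': "Measurable.pred ?N
        (\<lambda>x. m < K u \<and> real (hamming L (\<lambda>k. detect u k x) (code u m)) \<le> real D / 2)" for m
      using pred[of m] by (cases "m < K u") simp_all
    have iff: "2 * n \<le> D \<longleftrightarrow> real n \<le> real D / 2" for n by linarith
    have "(\<lambda>x. LEAST m. m < K u \<and> real (hamming L (\<lambda>k. detect u k x) (code u m)) \<le> real D / 2)
        \<in> ?N \<rightarrow>\<^sub>M count_space UNIV"
      by (rule measurable_Least[OF pred'])
    then show ?thesis unfolding dec_def iff .
  qed
  have csit: "csit P (L * 2) \<omega> (v, i) = He v P i \<omega>" if "i < L * 2" for v i \<omega>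
    using that by (simp add: csit_def)
  have csit_meas [measurable]: "csit P (L * 2) \<in> M \<rightarrow>\<^sub>M ?C"
    unfolding csit_def by measurable
  have sym_in: "sym m k \<in> {..<Q User1} \<times> {..<Q User2}"
    if "m \<in> {..<K User1} \<times> {..<K User2}" "k < L" for m k
    using that by (auto simp: sym_def intro!: code)
  have norm_enc: "norm (enc m i (csit P (L * 2) \<omega>)) \<in> {Off / 2..2 * Off}"
    if "m \<in> {..<K User1} \<times> {..<K User2}" "i < L * 2" for m i \<omega>
    using norm_signal[OF sym_in[OF that(1)], of "i div 2" "i mod 2"] that by (simp add: enc_def)
  have Off0: "0 \<le> Off"
    using norm_enc[of "(0, 0)" 0] norm_ge_zero[of "enc (0, 0) 0 (csit P (L * 2) undefined)"]
      K[of User1] K[of User2] L by fastforce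
  have pow: "(norm (enc m i (csit P (L * 2) \<omega>)))\<^sup>2 \<in> {(Off / 2)\<^sup>2..(2 * Off)\<^sup>2}"
    if "m \<in> {..<K User1} \<times> {..<K User2}" "i < L * 2" for m i \<omega>
    using norm_enc[OF that, of \<omega>] Off0 unfolding atLeastAtMost_iff
    by (intro conjI power_mono) simp_all
  have int: "integrable M (\<lambda>\<omega>. (norm (enc m i (csit P (L * 2) \<omega>)))\<^sup>2)"
    if "m \<in> {..<K User1} \<times> {..<K User2}" "i < L * 2" for m i
    by (rule integrable_const_bound[where B = "(2 * Off)\<^sup>2"]) (use pow[OF that] in auto)
  have power: "expectation (\<lambda>\<omega>. (norm (enc m i (csit P (L * 2) \<omega>)))\<^sup>2) \<in> {(Off / 2)\<^sup>2..(2 * Off)\<^sup>2}"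
    if "m \<in> {..<K User1} \<times> {..<K User2}" "i < L * 2" for m i
  proof -
    have "expectation (\<lambda>\<omega>. (Off / 2)\<^sup>2) \<le> expectation (\<lambda>\<omega>. (norm (enc m i (csit P (L * 2) \<omega>)))\<^sup>2)"
      by (intro integral_mono int[OF that]) (use pow[OF that] in auto)
    moreover have "expectation (\<lambda>\<omega>. (norm (enc m i (csit P (L * 2) \<omega>)))\<^sup>2) \<le> expectation (\<lambda>\<omega>. (2 * Off)\<^sup>2)"
      by (intro integral_mono int[OF that]) (use pow[OF that] in auto)
    ultimately show ?thesis by (simp add: prob_space)
  qed
  let ?x = "\<lambda>u m \<omega>. (received u P (L * 2) (enc m) \<omega>, own_csi u P (L * 2) \<omega>, csit P (L * 2) \<omega>)"
  have detect: "detect u k (?x u m \<omega>) = code u (msg u m) k"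
    if "m \<in> {..<K User1} \<times> {..<K User2}" "k < L" "channel_good u P t k \<omega>" "noise_good u t k \<omega>"
    for u m k \<omega>
  proof -
    have "detect u k (?x u m \<omega>) = msg u (sym m k)"
    proof (rule detect_correct[OF that(3,4) sym_in[OF that(1,2)]])
      fix j :: nat and v assume "j < 2"
      then have i: "2 * k + j < L * 2" "(2 * k + j) div 2 = k" "(2 * k + j) mod 2 = j"
        using that(2) by auto
      show "received u P (L * 2) (enc m) \<omega> (2 * k + j) = hdot (H u P (2 * k + j) \<omega>)
          (signal (sym m k) j (\<lambda>v. He v P (2 * k + j) \<omega>)) + Z u (2 * k + j) \<omega>"
        using i by (simp add: received_def enc_def csit)
      show "own_csi u P (L * 2) \<omega> (2 * k + j) = H u P (2 * k + j) \<omega>"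
        using i by (simp add: own_csi_def)
      show "csit P (L * 2) \<omega> (v, 2 * k + j) = He v P (2 * k + j) \<omega>"
        using i by (simp add: csit)
    qed
    then show ?thesis by (cases u) (simp_all add: sym_def)
  qed
  let ?E1 = "\<lambda>u. {\<omega> \<in> space M. 2 * \<eta> * real L \<le> real (card {k\<in>{..<L}. \<not> channel_good u P t k \<omega>})}"
  let ?E2 = "\<lambda>u. {\<omega> \<in> space M. 2 * \<eta> * real L \<le> real (card {k\<in>{..<L}. \<not> noise_good u t k \<omega>})}"
  have dec_ok: "dec u (?x u m \<omega>) = msg u m"
    if m: "m \<in> {..<K User1} \<times> {..<K User2}" and \<omega>: "\<omega> \<in> space M" "\<omega> \<notin> ?E1 u" "\<omega> \<notin> ?E2 u" for u m \<omega>
  proof -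
    have mK: "msg u m < K u" using m by (cases u) auto
    have "{k\<in>{..<L}. detect u k (?x u m \<omega>) \<noteq> code u (msg u m) k} \<subseteq>
        {k\<in>{..<L}. \<not> channel_good u P t k \<omega>} \<union> {k\<in>{..<L}. \<not> noise_good u t k \<omega>}"
      using detect[OF m] by blast
    then have "hamming L (\<lambda>k. detect u k (?x u m \<omega>)) (code u (msg u m)) \<le>
        card ({k\<in>{..<L}. \<not> channel_good u P t k \<omega>} \<union> {k\<in>{..<L}. \<not> noise_good u t k \<omega>})"
      unfolding hamming_def by (intro card_mono) auto
    also have "\<dots> \<le> card {k\<in>{..<L}. \<not> channel_good u P t k \<omega>} + card {k\<in>{..<L}. \<not> noise_good u t k \<omega>}"
      by (rule card_Un_le)
    finally have "real (hamming L (\<lambda>k. detect u k (?x u m \<omega>)) (code u (msg u m))) \<le>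
        real (card {k\<in>{..<L}. \<not> channel_good u P t k \<omega>}) + real (card {k\<in>{..<L}. \<not> noise_good u t k \<omega>})"
      by linarith
    moreover have "real (card {k\<in>{..<L}. \<not> channel_good u P t k \<omega>}) < 2 * \<eta> * real L"
      "real (card {k\<in>{..<L}. \<not> noise_good u t k \<omega>}) < 2 * \<eta> * real L" using \<omega> by auto
    ultimately have close: "2 * hamming L (\<lambda>k. detect u k (?x u m \<omega>)) (code u (msg u m)) \<le> D"
      using D by linarith
    show ?thesis
      unfolding dec_def
    proof (rule Least_equality)
      fix m' assume m': "m' < K u \<and> 2 * hamming L (\<lambda>k. detect u k (?x u m \<omega>)) (code u m') \<le> D"
      have "hamming L (code u (msg u m)) (code u m') \<le> D"
        using hamming_triangle[of L "code u (msg u m)" "code u m'" "\<lambda>k. detect u k (?x u m \<omega>)"]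
          hamming_commute[of L "code u (msg u m)" "\<lambda>k. detect u k (?x u m \<omega>)"] close m' by linarith
      then show "msg u m \<le> m'" using dist[OF mK, of m'] m' by force
    qed (use mK close in auto)
  qed
  have E12: "?E1 u \<in> events" "?E2 u \<in> events" for u
  proof -
    have [measurable]: "Measurable.pred M (\<lambda>\<omega>. \<not> channel_good u P t k \<omega>)"
      "Measurable.pred M (\<lambda>\<omega>. \<not> noise_good u t k \<omega>)" for k
      unfolding channel_good_def noise_good_def favourable_def by measurable
    show "?E1 u \<in> events" "?E2 u \<in> events" by measurable
  qed
  have err: "prob {\<omega> \<in> space M. dec u (?x u m \<omega>) \<noteq> msg u m} \<le> \<epsilon>"
    if m: "m \<in> {..<K User1} \<times> {..<K User2}" for u m
  proof -
    have "prob {\<omega> \<in> space M. dec u (?x u m \<omega>) \<noteq> msg u m} \<le> prob (?E1 u \<union> ?E2 u)"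
      using dec_ok[OF m] E12[of u] by (intro finite_measure_mono) blast+
    also have "\<dots> \<le> prob (?E1 u) + prob (?E2 u)"
      by (rule measure_Un_le) (rule E12)+
    also have "\<dots> \<le> exp (- 2 * \<eta>\<^sup>2 * real L) + exp (- 2 * \<eta>\<^sup>2 * real L)"
      by (intro add_mono channel_bad_count_tail noise_bad_count_tail \<eta> P_pos leak_pos L t0)
    finally show ?thesis using \<epsilon> by simp
  qed
  show ?thesis
    unfolding code_exists_def
  proof (intro exI conjI allI impI ballI)
    show "enc m i \<in> ?C \<rightarrow>\<^sub>M borel" for m i by (rule enc_meas)
    show "dec u \<in> ?N \<rightarrow>\<^sub>M count_space UNIV" for u by (rule dec_meas)
    show "integrable M (\<lambda>\<omega>. (norm (enc m i (csit P (L * 2) \<omega>)))\<^sup>2)"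
      if "i < L * 2" "m \<in> {..<K User1} \<times> {..<K User2}" for i m by (rule int[OF that(2,1)])
    show "msg_avg (K User1) (K User2) (\<lambda>m. expectation (\<lambda>\<omega>. (norm (enc m i (csit P (L * 2) \<omega>)))\<^sup>2))
        \<in> {(Off / 2)\<^sup>2..(2 * Off)\<^sup>2}" if "i < L * 2" for i
      by (intro msg_avg_bounds K power that)
    have "msg_avg (K User1) (K User2) (\<lambda>m. prob {\<omega> \<in> space M. dec u (?x u m \<omega>) \<noteq> msg u m}) \<in> {0..\<epsilon>}" for u
      using err by (intro msg_avg_bounds K) auto
    then show "msg_avg (K User1) (K User2) (\<lambda>m. prob {\<omega> \<in> space M. dec u (?x u m \<omega>) \<noteq> msg u m}) \<le> \<epsilon>" for u
      by simp
  qed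
qed

end

subsection \<open>Asymptotics and rates\<close>

lemma filterlim_log2_at_top: "filterlim (log (2::real)) at_top at_top"
proof -
  have "filterlim (\<lambda>x::real. ln x * (1 / ln 2)) at_top at_top"
    by (rule filterlim_at_top_mult_tendsto_pos[OF tendsto_const _ ln_at_top]) simp
  then show ?thesis by (simp add: log_def [abs_def])
qed

lemma eventually_log2_pos: "\<forall>\<^sub>F P in at_top. 0 < log 2 (P::real)"
  using eventually_gt_at_top[of "1::real"] by eventually_elim simp

section \<open>Calculus of exponents for \<open>pow_sim\<close>\<close>

lemma pow_sim_cong: "pow_sim f p \<Longrightarrow> p = q \<Longrightarrow> pow_sim f q"
  by simp

lemma pow_sim_pos: "pow_sim f p \<Longrightarrow> \<forall>\<^sub>F P in at_top. 0 < f P"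
  by (simp add: pow_sim_def)

lemma pow_sim_const: "0 < c \<Longrightarrow> pow_sim (\<lambda>_. c) 0"
  unfolding pow_sim_def
  using tendsto_divide_0[OF tendsto_const filterlim_at_top_imp_at_infinity[OF filterlim_log2_at_top]]
  by simp

lemma pow_sim_id: "pow_sim (\<lambda>P. P) 1"
  unfolding pow_sim_def
proof (intro conjI)
  show "((\<lambda>P. log 2 P / log 2 P) \<longlongrightarrow> 1) at_top"
    by (rule tendsto_eventually) (use eventually_log2_pos in eventually_elim, simp)
qed (rule eventually_gt_at_top)

text \<open>Logarithmic factors have exponent 0, so separating the levels by powers of
  \<open>t\<close> costs no degrees of freedom.\<close>

lemma pow_sim_log: "pow_sim (log 2) 0"
  unfolding pow_sim_def
proof (intro conjI eventually_log2_pos)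
  have "((\<lambda>x::real. ln x / x) \<longlongrightarrow> 0) at_top"
    using ln_x_over_x_tendsto_0 .
  then have "((\<lambda>x::real. (1 / ln 2) * (ln x / x)) \<longlongrightarrow> (1 / ln 2) * 0) at_top"
    by (intro tendsto_intros)
  from filterlim_compose[OF this filterlim_log2_at_top]
  show "((\<lambda>P. log 2 (log 2 P) / log 2 P) \<longlongrightarrow> 0) at_top"
    by (simp add: log_def)
qed

lemma pow_sim_mult:
  assumes "pow_sim f p" "pow_sim g q"
  shows "pow_sim (\<lambda>P. f P * g P) (p + q)"
  unfolding pow_sim_def
proof (intro conjI)
  have pos: "\<forall>\<^sub>F P in at_top. 0 < f P \<and> 0 < g P"
    using assms by (simp add: pow_sim_def eventually_conj)
  then show "\<forall>\<^sub>F P in at_top. 0 < f P * g P" by eventually_elim simp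
  have "((\<lambda>P. log 2 (f P) / log 2 P + log 2 (g P) / log 2 P) \<longlongrightarrow> p + q) at_top"
    using assms by (intro tendsto_add) (auto simp: pow_sim_def)
  then show "((\<lambda>P. log 2 (f P * g P) / log 2 P) \<longlongrightarrow> p + q) at_top"
    by (rule Lim_transform_eventually) (use pos in eventually_elim, simp add: log_mult add_divide_distrib)
qed

lemma pow_sim_powr:
  assumes "pow_sim f p"
  shows "pow_sim (\<lambda>P. f P powr r) (r * p)"
  unfolding pow_sim_def
proof (intro conjI)
  have pos: "\<forall>\<^sub>F P in at_top. 0 < f P" by (rule pow_sim_pos[OF assms])
  then show "\<forall>\<^sub>F P in at_top. 0 < f P powr r" by eventually_elim simp
  have "((\<lambda>P. r * (log 2 (f P) / log 2 P)) \<longlongrightarrow> r * p) at_top"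
    using assms by (intro tendsto_mult tendsto_const) (auto simp: pow_sim_def)
  then show "((\<lambda>P. log 2 (f P powr r) / log 2 P) \<longlongrightarrow> r * p) at_top"
    by (rule Lim_transform_eventually) (use pos in eventually_elim, simp add: log_powr)
qed

lemma pow_sim_transform:
  assumes "pow_sim f p" "\<forall>\<^sub>F P in at_top. f P = g P"
  shows "pow_sim g p"
  unfolding pow_sim_def
proof (intro conjI)
  show "\<forall>\<^sub>F P in at_top. 0 < g P"
    using pow_sim_pos[OF assms(1)] assms(2) by eventually_elim simp
  have "((\<lambda>P. log 2 (f P) / log 2 P) \<longlongrightarrow> p) at_top" using assms(1) by (simp add: pow_sim_def)
  then show "((\<lambda>P. log 2 (g P) / log 2 P) \<longlongrightarrow> p) at_top"
    by (rule Lim_transform_eventually) (use assms(2) in eventually_elim, simp)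
qed

lemma pow_sim_power: "pow_sim f p \<Longrightarrow> pow_sim (\<lambda>P. f P ^ n) (real n * p)"
  by (rule pow_sim_transform[OF pow_sim_powr[of f p "real n"]])
    (auto dest!: pow_sim_pos elim!: eventually_mono simp: powr_realpow)

lemma pow_sim_sqrt: "pow_sim f p \<Longrightarrow> pow_sim (\<lambda>P. sqrt (f P)) (p / 2)"
  by (rule pow_sim_cong[OF pow_sim_transform[OF pow_sim_powr[of f p "1 / 2"]]])
    (auto dest!: pow_sim_pos elim!: eventually_mono simp: powr_half_sqrt)

lemma pow_sim_divide:
  assumes "pow_sim f p" "pow_sim g q"
  shows "pow_sim (\<lambda>P. f P / g P) (p - q)"
  using pow_sim_mult[OF assms(1) pow_sim_powr[OF assms(2), of "-1"]]
  by (rule pow_sim_cong[OF pow_sim_transform])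
    (use pow_sim_pos[OF assms(2)] in \<open>auto elim!: eventually_mono simp: powr_minus divide_inverse\<close>)

lemma pow_sim_sandwich:
  assumes f: "pow_sim f p" and g: "pow_sim g p" and h: "\<forall>\<^sub>F P in at_top. f P \<le> h P \<and> h P \<le> g P"
  shows "pow_sim h p"
  unfolding pow_sim_def
proof (intro conjI)
  have all: "\<forall>\<^sub>F P in at_top. 0 < f P \<and> 0 < log 2 P \<and> f P \<le> h P \<and> h P \<le> g P"
    using pow_sim_pos[OF f] eventually_log2_pos h by eventually_elim simp
  then show "\<forall>\<^sub>F P in at_top. 0 < h P" by eventually_elim simp
  show "((\<lambda>P. log 2 (h P) / log 2 P) \<longlongrightarrow> p) at_top"
  proof (rule tendsto_sandwich)
    show "\<forall>\<^sub>F P in at_top. log 2 (f P) / log 2 P \<le> log 2 (h P) / log 2 P"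
      using all by eventually_elim (auto intro!: divide_right_mono)
    show "\<forall>\<^sub>F P in at_top. log 2 (h P) / log 2 P \<le> log 2 (g P) / log 2 P"
      using all by eventually_elim (auto intro!: divide_right_mono)
  qed (use f g in \<open>auto simp: pow_sim_def\<close>)
qed

lemma pow_sim_max:
  assumes f: "pow_sim f p" and g: "pow_sim g q"
  shows "pow_sim (\<lambda>P. max (f P) (g P)) (max p q)"
  unfolding pow_sim_def
proof (intro conjI)
  have all: "\<forall>\<^sub>F P in at_top. 0 < f P \<and> 0 < g P \<and> 0 < log 2 P"
    using pow_sim_pos[OF f] pow_sim_pos[OF g] eventually_log2_pos by eventually_elim simp
  then show "\<forall>\<^sub>F P in at_top. 0 < max (f P) (g P)"
    by eventually_elim (simp add: less_max_iff_disj)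
  have "((\<lambda>P. max (log 2 (f P) / log 2 P) (log 2 (g P) / log 2 P)) \<longlongrightarrow> max p q) at_top"
    using f g by (intro tendsto_max) (auto simp: pow_sim_def)
  then show "((\<lambda>P. log 2 (max (f P) (g P)) / log 2 P) \<longlongrightarrow> max p q) at_top"
  proof (rule Lim_transform_eventually)
    show "\<forall>\<^sub>F P in at_top. max (log 2 (f P) / log 2 P) (log 2 (g P) / log 2 P) = log 2 (max (f P) (g P)) / log 2 P"
      using all by eventually_elim (auto simp: max_def divide_le_cancel)
  qed
qed

lemma pow_sim_add:
  assumes f: "pow_sim f p" and g: "pow_sim g q"
  shows "pow_sim (\<lambda>P. f P + g P) (max p q)"
proof (rule pow_sim_sandwich[OF pow_sim_max[OF f g]])
  show "pow_sim (\<lambda>P. 2 * max (f P) (g P)) (max p q)"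
    using pow_sim_mult[OF pow_sim_const pow_sim_max[OF f g], of 2] by simp
  show "\<forall>\<^sub>F P in at_top. max (f P) (g P) \<le> f P + g P \<and> f P + g P \<le> 2 * max (f P) (g P)"
    using pow_sim_pos[OF f] pow_sim_pos[OF g] by eventually_elim auto
qed

text \<open>The result lies between \<open>f P\<close> and \<open>f P + 1\<close>, and adding 1 does
  not change a nonnegative exponent. This is the number of points on a side of a grid.\<close>

lemma pow_sim_Suc_floor:
  assumes f: "pow_sim f p" and "0 \<le> p"
  shows "pow_sim (\<lambda>P. real (nat \<lfloor>f P\<rfloor>) + 1) p"
proof (rule pow_sim_sandwich[OF f])
  show "pow_sim (\<lambda>P. f P + 1) p"
    using pow_sim_add[OF f pow_sim_const[of 1]] \<open>0 \<le> p\<close> by (simp add: max_def)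
  show "\<forall>\<^sub>F P in at_top. f P \<le> real (nat \<lfloor>f P\<rfloor>) + 1 \<and> real (nat \<lfloor>f P\<rfloor>) + 1 \<le> f P + 1"
    using pow_sim_pos[OF f]
  proof eventually_elim
    case (elim P)
    then have "real (nat \<lfloor>f P\<rfloor>) = of_int \<lfloor>f P\<rfloor>" by simp
    then show ?case by linarith
  qed
qed

lemma pow_sim_floor:
  assumes f: "pow_sim f p" and "\<forall>\<^sub>F P in at_top. 1 \<le> f P"
  shows "pow_sim (\<lambda>P. real (nat \<lfloor>f P\<rfloor>)) p"
proof (rule pow_sim_sandwich[OF _ f])
  show "pow_sim (\<lambda>P. f P / 2) p"
    using pow_sim_divide[OF f pow_sim_const[of 2]] by simp
  show "\<forall>\<^sub>F P in at_top. f P / 2 \<le> real (nat \<lfloor>f P\<rfloor>) \<and> real (nat \<lfloor>f P\<rfloor>) \<le> f P"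
    using assms(2)
  proof eventually_elim
    case (elim P)
    then have "1 \<le> \<lfloor>f P\<rfloor>" by linarith
    then have "real (nat \<lfloor>f P\<rfloor>) = of_int \<lfloor>f P\<rfloor>" "1 \<le> real (nat \<lfloor>f P\<rfloor>)" by auto
    then show ?case by linarith
  qed
qed

text \<open>The subtracted 2 pays, per letter, one bit for the factor \<open>2 ^ L\<close> and one
  for rounding \<open>D\<close> up, which costs \<open>log 2 (real Q)\<close> bits in all, at most
  \<open>L\<close>. For \<open>R = 0\<close> there is a single message and nothing to
  separate.\<close>

lemma gilbert_varshamov_rate:
  assumes Q: "1 \<le> Q" and "0 < \<eta>" and R: "R = 0 \<or> R \<le> (1 - 8 * \<eta>) * log 2 (real Q) - 2"
    and L: "log 2 (real Q) \<le> real L" and K: "K = nat \<lceil>2 powr (real L * R)\<rceil>" and D: "D = nat \<lceil>8 * \<eta> * real L\<rceil>"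
  shows "1 \<le> K \<and> (K - 1) * (2 ^ L * Q ^ D) < Q ^ L"
proof (cases "R = 0")
  case True then show ?thesis using K Q by simp
next
  case False
  define x where "x = 2 powr (real L * R)"
  have x: "0 < x" by (simp add: x_def)
  have K1: "1 \<le> K" using x unfolding K x_def[symmetric] by linarith
  have "real K < x + 1" using x unfolding K x_def[symmetric] by linarith
  then have K2: "real (K - 1) < x" using K1 by (simp add: of_nat_diff)
  let ?l = "log 2 (real Q)"
  have l: "0 \<le> ?l" using Q by simp
  have "0 \<le> 8 * \<eta> * real L" using \<open>0 < \<eta>\<close> by simp
  then have "real D \<le> 8 * \<eta> * real L + 1" unfolding D by linarith
  then have D': "?l * real D \<le> ?l * (8 * \<eta> * real L + 1)" using l by (intro mult_left_mono) auto
  have Qpow: "real Q ^ n = 2 powr (?l * real n)" for n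
    using Q by (simp add: powr_powr[symmetric] powr_realpow)
  have R': "real L * R \<le> real L * ((1 - 8 * \<eta>) * ?l - 2)"
    using R False by (intro mult_left_mono) auto
  have "real ((K - 1) * (2 ^ L * Q ^ D)) = real (K - 1) * (2 ^ L * real Q ^ D)" by simp
  also have "\<dots> < x * (2 ^ L * real Q ^ D)"
    using K2 Q by (intro mult_strict_right_mono) auto
  also have "\<dots> = 2 powr (real L * R + (real L + ?l * real D))"
    unfolding x_def Qpow by (simp add: powr_add powr_realpow)
  also have "\<dots> \<le> 2 powr (?l * real L)"
    using R' D' L by (intro powr_mono) (simp_all add: algebra_simps)
  also have "\<dots> = real (Q ^ L)" using Qpow[of L] by simp
  finally show ?thesis using K1 by linarith
qed

text \<open>A letter of user \<open>u\<close> is split by division by \<open>q u\<close>. The two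
  remainders are injected jointly into the common and repeated grids, which both users resolve,
  while each quotient is injected into the private grids of its user.\<close>

lemma superposition_symbols_exist:
  fixes nx nc :: nat and a :: "bool \<Rightarrow> nat" and q :: "user \<Rightarrow> nat"
  assumes q: "q User1 * q User2 \<le> ((nx + 1)\<^sup>2)\<^sup>2 * (nc + 1)\<^sup>2"
    and Q: "\<And>u. Q u = q u * ((a False + 1)\<^sup>2 * (a True + 1)\<^sup>2)"
  obtains X :: "nat \<times> nat \<Rightarrow> nat \<Rightarrow> complex" and C :: "nat \<times> nat \<Rightarrow> complex"
    and W :: "user \<Rightarrow> nat \<Rightarrow> nat \<Rightarrow> complex"
  where "\<And>b j. b \<in> {..<Q User1} \<times> {..<Q User2} \<Longrightarrow> j < 2 \<Longrightarrow> X b j \<in> gauss_grid nx"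
    and "\<And>b. b \<in> {..<Q User1} \<times> {..<Q User2} \<Longrightarrow> C b \<in> gauss_grid nc"
    and "\<And>m u j. m < Q u \<Longrightarrow> j < 2 \<Longrightarrow> W u m j \<in> gauss_grid (a (reported (other u) j))"
    and "\<And>b b' u. \<lbrakk>b \<in> {..<Q User1} \<times> {..<Q User2}; b' \<in> {..<Q User1} \<times> {..<Q User2};
        \<And>j. j < 2 \<Longrightarrow> X b j = X b' j; C b = C b';
        \<And>j. j < 2 \<Longrightarrow> W u (msg u b) j = W u (msg u b') j\<rbrakk> \<Longrightarrow> msg u b = msg u b'"
proof -
  define p where "p = (a False + 1)\<^sup>2 * (a True + 1)\<^sup>2"
  have p0: "0 < p" by (simp add: p_def)
  let ?G = "gauss_grid nx \<times> gauss_grid nx \<times> gauss_grid nc"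
  have "card ({..<q User1} \<times> {..<q User2}) \<le> card ?G"
    using q unfolding card_cartesian_product card_gauss_grid card_lessThan
    by (simp only: power2_eq_square mult.assoc)
  from card_le_inj[OF _ _ this] obtain f :: "nat \<times> nat \<Rightarrow> complex \<times> complex \<times> complex" where
    f: "f ` ({..<q User1} \<times> {..<q User2}) \<subseteq> ?G" "inj_on f ({..<q User1} \<times> {..<q User2})"
    by auto
  let ?P = "\<lambda>u. gauss_grid (a (reported (other u) 0)) \<times> gauss_grid (a (reported (other u) 1))"
  have "card {..<p} \<le> card (?P u)" for u
    by (cases u) (simp_all add: card_cartesian_product card_gauss_grid p_def reported_def mult_ac)
  then have "\<exists>g. g ` {..<p} \<subseteq> ?P u \<and> inj_on g {..<p}" for u
    using card_le_inj[of "{..<p}" "?P u"] by simp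
  then obtain g where g: "\<And>u. g u ` {..<p} \<subseteq> ?P u" "\<And>u. inj_on (g u) {..<p}" by metis
  define F where "F b = f (fst b mod q User1, snd b mod q User2)" for b
  define X where "X b j = (if j = 0 then fst (F b) else fst (snd (F b)))" for b and j :: nat
  define C where "C b = snd (snd (F b))" for b
  define W where "W u m j = (if j = 0 then fst (g u (m div q u)) else snd (g u (m div q u)))"
    for u m and j :: nat
  have Qp: "Q u = q u * p" for u by (simp add: Q p_def)
  have pos: "0 < q u" if "m < Q u" for u m using that by (cases "q u") (auto simp: Qp)
  have div_less: "m div q u < p" if "m < Q u" for u m
    using that by (simp add: Qp less_mult_imp_div_less mult.commute)
  have mods: "(fst b mod q User1, snd b mod q User2) \<in> {..<q User1} \<times> {..<q User2}"
    if "b \<in> {..<Q User1} \<times> {..<Q User2}" for b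
    using that pos[of _ User1] pos[of _ User2] by auto
  have Fin: "F b \<in> ?G" if "b \<in> {..<Q User1} \<times> {..<Q User2}" for b
    using f(1) mods[OF that] unfolding F_def by blast
  have gin: "g u (m div q u) \<in> ?P u" if "m < Q u" for u m
    using g(1)[of u] div_less[OF that] by blast
  show thesis
  proof (rule that)
    show "X b j \<in> gauss_grid nx" if "b \<in> {..<Q User1} \<times> {..<Q User2}" "j < 2" for b j
      using Fin[OF that(1)] by (auto simp: X_def mem_Times_iff)
    show "C b \<in> gauss_grid nc" if "b \<in> {..<Q User1} \<times> {..<Q User2}" for b
      using Fin[OF that] by (auto simp: C_def mem_Times_iff)
    show "W u m j \<in> gauss_grid (a (reported (other u) j))" if "m < Q u" "j < 2" for m u j
      using gin[OF that(1)] that(2) by (auto simp: W_def mem_Times_iff less_2_cases_iff)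
  next
    fix b b' u
    assume b: "b \<in> {..<Q User1} \<times> {..<Q User2}" "b' \<in> {..<Q User1} \<times> {..<Q User2}"
      and X: "\<And>j. j < 2 \<Longrightarrow> X b j = X b' j" and C: "C b = C b'"
      and W: "\<And>j. j < 2 \<Longrightarrow> W u (msg u b) j = W u (msg u b') j"
    have "F b = F b'" using X[of 0] X[of 1] C by (simp add: X_def C_def prod_eq_iff)
    then have "(fst b mod q User1, snd b mod q User2) = (fst b' mod q User1, snd b' mod q User2)"
      using f(2) mods[OF b(1)] mods[OF b(2)] unfolding F_def inj_on_def by blast
    then have 1: "msg u b mod q u = msg u b' mod q u" by (cases u) auto
    have m: "msg u b < Q u" "msg u b' < Q u" using b by (cases u; auto)+
    have "g u (msg u b div q u) = g u (msg u b' div q u)"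
      using W[of 0] W[of 1] by (simp add: W_def prod_eq_iff)
    then have "msg u b div q u = msg u b' div q u"
      using g(2)[of u] div_less[OF m(1)] div_less[OF m(2)] unfolding inj_on_def by blast
    with 1 show "msg u b = msg u b'" by (metis div_mult_mod_eq)
  qed
qed

subsection \<open>Achievability\<close>

context alternating_csit
begin

text \<open>The share \<open>l u\<close> of the common capacity goes to user \<open>u\<close>. In
  cardinalities, the common grids have exponent \<open>2 - \<alpha> - \<beta>\<close> and the
  private grids of each user \<open>\<alpha> + \<beta>\<close>; half of the total is the DoF, as a
  pair counts as two channel uses.\<close>

lemma dof_achievable_split:
  fixes d l :: "user \<Rightarrow> real"
  assumes \<alpha>\<beta>: "0 \<le> \<alpha>" "\<alpha> \<le> \<beta>" "\<beta> \<le> 1"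
    and d: "\<And>u. 0 \<le> d u" "\<And>u. 2 * d u \<le> \<alpha> + \<beta> + l u * (2 - \<alpha> - \<beta>)"
    and l: "\<And>u. 0 \<le> l u" "l User1 + l User2 = 1"
  shows "dof_achievable (d User1) (d User2)"
proof -
  define t :: "real \<Rightarrow> real" where "t = log 2"
  \<comment> \<open>By \<open>leak_eq\<close> the leakage depends only on whether the channel is
    reported, so user 1 on subbands 0 and 1 represents both cases.\<close>
  define lk where "lk b P = leak User1 P (if b then 0 else 1)" for b P
  define e where "e b = (if b then \<beta> else \<alpha>)" for b
  \<comment> \<open>The largest grid size allowed by \<open>a_leak\<close>. The sizes
    \<open>nc\<close> and \<open>nx\<close> then fill the gap between the two private amplitudes and
    the range from there up to \<open>sqrt P\<close>.\<close>
  define a where "a P b = nat \<lfloor>1 / (t P ^ 3 * sqrt (lk b P))\<rfloor>" for P b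
  define nc where "nc P = nat \<lfloor>(real (a P True) + 1) / (real (a P False) + 1)\<rfloor>" for P
  define B where "B P = t P ^ 6 * (real (a P False) + 1)" for P
  define A where "A P = t P ^ 3 * (B P * (real (nc P) + 1) + t P ^ 3 * (real (a P True) + 1))" for P
  define nx where "nx P = nat \<lfloor>sqrt P / A P\<rfloor>" for P
  \<comment> \<open>The \<open>+ 1\<close> in each factor matches the quantities whose exponents are
    computed below. The largest exponent is 1/2, which gives power of order
    \<open>P\<close>.\<close>
  define Off where "Off P = 4 * (sqrt P + (A P * (real (nx P) + 1) + (B P * (real (nc P) + 1)
      + (t P ^ 3 * (real (a P False) + 1) + t P ^ 3 * (real (a P True) + 1)))))" for P
  define Qc where "Qc P = ((nx P + 1)\<^sup>2)\<^sup>2 * (nc P + 1)\<^sup>2" for P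
  \<comment> \<open>Rounding down keeps the product of the two values at most \<open>Qc P\<close>,
    because the shares sum to 1.\<close>
  define q where "q P u = nat \<lfloor>real (Qc P) powr l u\<rfloor>" for P u
  define Q where "Q P u = q P u * ((a P False + 1)\<^sup>2 * (a P True + 1)\<^sup>2)" for P u
  define cap where "cap u = \<alpha> + \<beta> + l u * (2 - \<alpha> - \<beta>)" for u
  \<comment> \<open>The summand \<open>1 / t P\<close> makes this strictly positive, as Hoeffding's
    bound requires, and still vanishes.\<close>
  define \<eta> where "\<eta> P = channel_fail (t P) + noise_fail (t P) + 1 / t P" for P
  define Y where "Y u P = (1 - 8 * \<eta> P) * log 2 (real (Q P u)) - 2" for u P
  \<comment> \<open>Capping by \<open>Y\<close> makes the rate admissible for the outer code at each
    suitable \<open>P\<close>, and \<open>max 0\<close> keeps it nonnegative. In the limit neither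
    binds, because \<open>2 * d u\<close> is at most \<open>cap u\<close>.\<close>
  define R where "R u P = max 0 (min (2 * d u * log 2 P) (Y u P))" for u P

  have t: "pow_sim t 0" unfolding t_def by (rule pow_sim_log)
  have lk: "pow_sim (lk b) (- e b)" for b
    using leak_quality[of User1 "if b then 0 else 1"]
    by (cases b) (simp_all add: lk_def [abs_def] e_def reported_def)
  have leak_lk: "leak u P i = lk (reported u i) P" if "0 < P" for u P i
    unfolding lk_def by (rule leak_eq) (use that in \<open>auto simp: reported_def\<close>)
  have e: "0 \<le> e b" "e b \<le> 1" for b using \<alpha>\<beta> by (auto simp: e_def)
  have a: "pow_sim (\<lambda>P. real (a P b) + 1) (e b / 2)" for b
    unfolding a_def
    by (rule pow_sim_Suc_floor[OF pow_sim_cong[OF pow_sim_divide[OF pow_sim_const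
            pow_sim_mult[OF pow_sim_power[OF t] pow_sim_sqrt[OF lk]]]]]) (use e in auto)
  have aT: "pow_sim (\<lambda>P. real (a P True) + 1) (\<beta> / 2)" and aF: "pow_sim (\<lambda>P. real (a P False) + 1) (\<alpha> / 2)"
    using a[of True] a[of False] by (simp_all add: e_def)
  have nc: "pow_sim (\<lambda>P. real (nc P) + 1) ((\<beta> - \<alpha>) / 2)"
    unfolding nc_def
    by (rule pow_sim_Suc_floor[OF pow_sim_cong[OF pow_sim_divide[OF aT aF]]]) (use \<alpha>\<beta> in \<open>auto simp: field_simps\<close>)
  have B: "pow_sim B (\<alpha> / 2)"
    unfolding B_def [abs_def] by (rule pow_sim_cong[OF pow_sim_mult[OF pow_sim_power[OF t] aF]]) simp
  have Bnc: "pow_sim (\<lambda>P. B P * (real (nc P) + 1)) (\<beta> / 2)"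
    by (rule pow_sim_cong[OF pow_sim_mult[OF B nc]]) (simp add: field_simps)
  have ta: "pow_sim (\<lambda>P. t P ^ 3 * (real (a P b) + 1)) (e b / 2)" for b
    by (rule pow_sim_cong[OF pow_sim_mult[OF pow_sim_power[OF t] a]]) simp
  have A: "pow_sim A (\<beta> / 2)"
    unfolding A_def [abs_def]
    by (rule pow_sim_cong[OF pow_sim_mult[OF pow_sim_power[OF t] pow_sim_add[OF Bnc ta]]]) (simp add: e_def)
  have nx: "pow_sim (\<lambda>P. real (nx P) + 1) ((1 - \<beta>) / 2)"
    unfolding nx_def
    by (rule pow_sim_Suc_floor[OF pow_sim_cong[OF pow_sim_divide[OF pow_sim_sqrt[OF pow_sim_id] A]]])
      (use \<alpha>\<beta> in \<open>auto simp: field_simps\<close>)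
  have Off: "pow_sim Off (1 / 2)"
    unfolding Off_def [abs_def]
    by (rule pow_sim_cong[OF pow_sim_mult[OF pow_sim_const pow_sim_add[OF pow_sim_sqrt[OF pow_sim_id]
          pow_sim_add[OF pow_sim_mult[OF A nx] pow_sim_add[OF Bnc pow_sim_add[OF ta ta]]]]]])
      (use \<alpha>\<beta> in \<open>auto simp: e_def field_simps max_def\<close>)
  have Qc: "pow_sim (\<lambda>P. real (Qc P)) (2 - \<alpha> - \<beta>)"
  proof -
    have "pow_sim (\<lambda>P. ((real (nx P) + 1)\<^sup>2)\<^sup>2 * (real (nc P) + 1)\<^sup>2) (2 - \<alpha> - \<beta>)"
      by (rule pow_sim_cong[OF pow_sim_mult[OF pow_sim_power[OF pow_sim_power[OF nx]] pow_sim_power[OF nc]]])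
        (simp add: field_simps)
    then show ?thesis by (simp add: Qc_def add.commute)
  qed
  have Qc1: "1 \<le> Qc P" for P by (simp add: Qc_def)
  have Qcl1: "1 \<le> real (Qc P) powr l u" for P u
    using Qc1[of P] l(1)[of u] by (intro ge_one_powr_ge_zero) auto
  have Q: "pow_sim (\<lambda>P. real (Q P u)) (cap u)" for u
  proof -
    have "pow_sim (\<lambda>P. real (q P u)) (l u * (2 - \<alpha> - \<beta>))"
      unfolding q_def by (rule pow_sim_floor[OF pow_sim_powr[OF Qc]]) (simp add: Qcl1)
    then have "pow_sim (\<lambda>P. real (q P u) * ((real (a P False) + 1)\<^sup>2 * (real (a P True) + 1)\<^sup>2)) (cap u)"
      by (rule pow_sim_cong[OF pow_sim_mult[OF _ pow_sim_mult[OF pow_sim_power[OF aF] pow_sim_power[OF aT]]]])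
        (simp add: cap_def field_simps)
    then show ?thesis by (simp add: Q_def add.commute)
  qed
  have q1: "1 \<le> q P u" for P u
    using Qcl1[of P u] unfolding q_def by linarith
  have Q1: "1 \<le> Q P u" for P u
    using q1[of P u] by (simp add: Q_def Suc_le_eq)
  have qq: "q P User1 * q P User2 \<le> Qc P" for P
  proof -
    have "real (q P u) \<le> real (Qc P) powr l u" for u unfolding q_def by simp
    then have "real (q P User1) * real (q P User2) \<le> real (Qc P) powr l User1 * real (Qc P) powr l User2"
      by (intro mult_mono) auto
    also have "\<dots> = real (Qc P)" using Qc1[of P] l(2) by (simp flip: powr_add)
    finally show ?thesis by (simp flip: of_nat_mult)
  qed

  have t_top: "filterlim t at_top at_top" unfolding t_def by (rule filterlim_log2_at_top)
  have \<eta>: "(\<eta> \<longlongrightarrow> 0) at_top"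
  proof -
    have "(\<eta> \<longlongrightarrow> 0 + 0 + 0) at_top"
      unfolding \<eta>_def [abs_def]
      by (intro tendsto_add filterlim_compose[OF fail_tendsto_0(1) t_top]
          filterlim_compose[OF fail_tendsto_0(2) t_top]
          tendsto_divide_0[OF tendsto_const filterlim_at_top_imp_at_infinity[OF t_top]])
    then show ?thesis by simp
  qed
  have Y: "((\<lambda>P. Y u P / log 2 P) \<longlongrightarrow> cap u) at_top" for u
  proof -
    have "((\<lambda>P. (1 - 8 * \<eta> P) * (log 2 (real (Q P u)) / log 2 P) - 2 / log 2 P) \<longlongrightarrow> (1 - 8 * 0) * cap u - 0) at_top"
      using Q[of u] by (intro tendsto_intros \<eta>
          tendsto_divide_0[OF tendsto_const filterlim_at_top_imp_at_infinity[OF filterlim_log2_at_top]])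
        (simp add: pow_sim_def)
    then show ?thesis by (simp add: Y_def diff_divide_distrib)
  qed
  have R: "((\<lambda>P. R u P / (real (2 * 1) * log 2 P)) \<longlongrightarrow> d u) at_top" for u
  proof -
    have "((\<lambda>P. max 0 (min (2 * d u) (Y u P / log 2 P)) / 2) \<longlongrightarrow> max 0 (min (2 * d u) (cap u)) / 2) at_top"
      by (intro tendsto_intros tendsto_max tendsto_min Y) simp
    also have "max 0 (min (2 * d u) (cap u)) / 2 = d u" using d[of u] by (simp add: cap_def)
    finally show ?thesis
    proof (rule Lim_transform_eventually)
      show "\<forall>\<^sub>F P in at_top. max 0 (min (2 * d u) (Y u P / log 2 P)) / 2 = R u P / (real (2 * 1) * log 2 P)"
        using eventually_log2_pos
        by eventually_elim (use d(1)[of u] in \<open>auto simp: R_def max_def min_def field_simps\<close>)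
    qed
  qed

  have good: "\<forall>\<^sub>F P in at_top. 0 < P \<and> 8 \<le> t P \<and> 0 < lk True P \<and> 0 < lk False P"
    using eventually_gt_at_top[of 0] filterlim_at_top[THEN iffD1, OF t_top, rule_format, of 8]
      pow_sim_pos[OF lk[of True]] pow_sim_pos[OF lk[of False]]
    by eventually_elim simp
  have "rates_achievable P (2 * 1) ((Off P / 2)\<^sup>2) ((2 * Off P)\<^sup>2) (R User1 P) (R User2 P)"
    if P: "0 < P" and t8: "8 \<le> t P" and lkP: "0 < lk True P" "0 < lk False P" for P
  proof -
    have lk_pos: "0 < lk b P" for b using lkP by (cases b) auto
    have B0: "0 < B P" unfolding B_def using t8 by (intro mult_pos_pos) auto
    have t3: "0 < t P ^ 3" using t8 by simp
    have "0 < B P * (real (nc P) + 1)" "0 < t P ^ 3 * (real (a P True) + 1)"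
      using B0 t3 by simp_all
    then have A0: "0 < A P" unfolding A_def by (rule mult_pos_pos[OF t3 add_pos_pos])
    obtain X :: "nat \<times> nat \<Rightarrow> nat \<Rightarrow> complex" and C :: "nat \<times> nat \<Rightarrow> complex"
      and W :: "user \<Rightarrow> nat \<Rightarrow> nat \<Rightarrow> complex" where
      sym: "\<And>b j. b \<in> {..<Q P User1} \<times> {..<Q P User2} \<Longrightarrow> j < 2 \<Longrightarrow> X b j \<in> gauss_grid (nx P)"
      "\<And>b. b \<in> {..<Q P User1} \<times> {..<Q P User2} \<Longrightarrow> C b \<in> gauss_grid (nc P)"
      "\<And>m u j. m < Q P u \<Longrightarrow> j < 2 \<Longrightarrow> W u m j \<in> gauss_grid (a P (reported (other u) j))"
      "\<And>b b' u. \<lbrakk>b \<in> {..<Q P User1} \<times> {..<Q P User2}; b' \<in> {..<Q P User1} \<times> {..<Q P User2};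
        \<And>j. j < 2 \<Longrightarrow> X b j = X b' j; C b = C b';
        \<And>j. j < 2 \<Longrightarrow> W u (msg u b) j = W u (msg u b') j\<rbrakk> \<Longrightarrow> msg u b = msg u b'"
      using superposition_symbols_exist[of "q P" "nx P" "nc P" "Q P" "a P"] qq[of P]
      unfolding Qc_def Q_def by blast
    interpret superposition "t P" "A P" "B P" "Off P" "nx P" "nc P" "a P" "Q P" X C W
    proof (rule superposition.intro)
      have "0 \<le> sqrt P" "0 \<le> t P ^ 3" using P t8 by auto
      then show "4 * (A P * real (nx P) + B P * real (nc P) + t P ^ 3 * real (a P False) + t P ^ 3 * real (a P True)) \<le> Off P"
        using A0 B0 by (simp add: Off_def algebra_simps)
    qed (use t8 sym in \<open>auto simp: A_def B_def\<close>)
    interpret superposition_csit M H He Z \<mu> \<alpha> \<beta> "t P" "A P" "B P" "Off P" "nx P" "nc P" "a P" "Q P" X C W P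
    proof unfold_locales
      show "0 < P" by (rule P)
      show "0 < leak u P i" for u i using lk_pos leak_lk[OF P] by simp
      show "real (a P (reported u j)) * sqrt (leak u P j) \<le> 1 / t P ^ 3" for u j
      proof -
        define b where "b = reported u j"
        have "real (a P b) \<le> 1 / (t P ^ 3 * sqrt (lk b P))"
          unfolding a_def using t8 lk_pos[of b] by simp
        then have "real (a P b) * sqrt (lk b P) \<le> 1 / (t P ^ 3 * sqrt (lk b P)) * sqrt (lk b P)"
          using lk_pos[of b] by (intro mult_right_mono) auto
        also have "\<dots> = 1 / t P ^ 3" using lk_pos[of b] by simp
        finally show ?thesis by (simp add: leak_lk[OF P] b_def)
      qed
    qed
    have fail0: "0 \<le> channel_fail (t P)" "0 \<le> noise_fail (t P)"
      using small_ball_nonneg[OF prob_space_law, of "1 / t P"]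
      by (auto simp: channel_fail_def noise_fail_def intro!: add_nonneg_nonneg)
    have t0: "0 < 1 / t P" using t8 by simp
    have \<eta>P: "channel_fail (t P) \<le> \<eta> P" "noise_fail (t P) \<le> \<eta> P" "0 < \<eta> P"
      unfolding \<eta>_def using fail0 t0 by linarith+
    show ?thesis
      unfolding rates_achievable_def
    proof (intro conjI allI impI)
      fix \<epsilon> :: real assume \<epsilon>: "0 < \<epsilon>"
      have large: "\<forall>\<^sub>F L in sequentially. x \<le> real L" for x
        using filterlim_real_sequentially unfolding filterlim_at_top by blast
      show "\<forall>\<^sub>F L in sequentially. code_exists P (L * (2 * 1)) ((Off P / 2)\<^sup>2) ((2 * Off P)\<^sup>2)
          (nat \<lceil>2 powr (real L * R User1 P)\<rceil>) (nat \<lceil>2 powr (real L * R User2 P)\<rceil>) \<epsilon>"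
        \<comment> \<open>The thresholds give \<open>0 < L\<close>, absorb the rounding of
          \<open>D\<close> for both users, and bring the two tail probabilities down to
          \<open>\<epsilon>\<close> in total.\<close>
        using large[of 1] large[of "log 2 (real (Q P User1))"] large[of "log 2 (real (Q P User2))"]
          large[of "ln (2 / \<epsilon>) / (2 * (\<eta> P)\<^sup>2)"]
      proof eventually_elim
        case (elim L)
        define D where "D = nat \<lceil>8 * \<eta> P * real L\<rceil>"
        define K where "K u = nat \<lceil>2 powr (real L * R u P)\<rceil>" for u
        have gv: "1 \<le> K u \<and> (K u - 1) * (2 ^ L * Q P u ^ D) < Q P u ^ L" for u
        proof (rule gilbert_varshamov_rate[OF Q1 \<eta>P(3) _ _ K_def D_def])
          show "R u P = 0 \<or> R u P \<le> (1 - 8 * \<eta> P) * log 2 (real (Q P u)) - 2"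
            by (auto simp: R_def Y_def max_def min_def)
          show "log 2 (real (Q P u)) \<le> real L" using elim by (cases u) auto
        qed
        have "ln (2 / \<epsilon>) \<le> 2 * (\<eta> P)\<^sup>2 * real L"
          using elim(4) \<eta>P(3) by (simp add: pos_divide_le_eq mult.commute)
        then have "exp (- 2 * (\<eta> P)\<^sup>2 * real L) \<le> exp (- ln (2 / \<epsilon>))" by simp
        also have "\<dots> = \<epsilon> / 2" using \<epsilon> by (simp add: exp_minus)
        finally have "2 * exp (- 2 * (\<eta> P)\<^sup>2 * real L) \<le> \<epsilon>" by simp
        then have "code_exists P (L * 2) ((Off P / 2)\<^sup>2) ((2 * Off P)\<^sup>2) (K User1) (K User2) \<epsilon>"
          using elim(1) gv Q1
          by (intro code_exists_superposition[OF \<eta>P, where D = D]) (auto simp: D_def real_nat_ceiling_ge)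
        then show ?case by (simp add: K_def)
      qed
    qed (simp_all add: R_def)
  qed
  then have rates: "\<forall>\<^sub>F P in at_top. rates_achievable P (2 * 1) ((Off P / 2)\<^sup>2) ((2 * Off P)\<^sup>2) (R User1 P) (R User2 P)"
    using good by (auto elim: eventually_mono)
  have pmin: "pow_sim (\<lambda>P. (Off P / 2)\<^sup>2) 1"
    using pow_sim_power[OF pow_sim_divide[OF Off pow_sim_const[of 2]], of 2] by simp
  have pmax: "pow_sim (\<lambda>P. (2 * Off P)\<^sup>2) 1"
    using pow_sim_power[OF pow_sim_mult[OF pow_sim_const[of 2] Off], of 2] by simp
  show ?thesis
    unfolding dof_achievable_def
    using pmin pmax rates R[of User1] R[of User2] by (intro exI[of _ 1] conjI) blast+
qed

end

section \<open>The region inside a pentagon, and the division of the common rate\<close>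

lemma dof_region_bounds:
  assumes "(d1, d2) \<in> dof_region \<alpha> \<beta>" and "0 \<le> \<alpha>" "\<alpha> \<le> \<beta>" "\<beta> \<le> 1"
  shows "0 \<le> d1 \<and> d1 \<le> 1 \<and> 0 \<le> d2 \<and> d2 \<le> 1 \<and> d1 + d2 \<le> (2 + \<alpha> + \<beta>) / 2"
proof -
  define S where "S = {x :: real \<times> real. 0 \<le> fst x \<and> fst x \<le> 1 \<and> 0 \<le> snd x \<and> snd x \<le> 1
    \<and> fst x + snd x \<le> (2 + \<alpha> + \<beta>) / 2}"
  have "convex S"
  proof (rule convexI)
    fix x y :: "real \<times> real" and u v :: real
    assume xy: "x \<in> S" "y \<in> S" and uv: "0 \<le> u" "0 \<le> v" "u + v = 1"
    have conv: "u * p + v * r \<le> c" if "p \<le> c" "r \<le> c" for p r c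
      using convex_bound_le[OF that uv] .
    have "u * (fst x + snd x) + v * (fst y + snd y) \<le> (2 + \<alpha> + \<beta>) / 2"
      using xy by (intro conv) (auto simp: S_def)
    moreover have "u * fst x + v * fst y \<le> 1" "u * snd x + v * snd y \<le> 1"
      using xy by (auto intro!: conv simp: S_def)
    moreover have "0 \<le> u * fst x + v * fst y" "0 \<le> u * snd x + v * snd y"
      using xy uv by (auto simp: S_def)
    ultimately show "u *\<^sub>R x + v *\<^sub>R y \<in> S" by (simp add: S_def algebra_simps)
  qed
  \<comment> \<open>As \<open>S\<close> is convex, it suffices to check the generating
    points.\<close>
  then have "dof_region \<alpha> \<beta> \<subseteq> S"
    unfolding dof_region_def
    by (intro hull_minimal) (use assms(2-) in \<open>auto simp: S_def max_def min_def field_simps\<close>)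
  with assms(1) show ?thesis by (auto simp: S_def)
qed

text \<open>If the private rate suffices for user 1, all common rate goes to user 2. Otherwise user
  1 gets exactly what is missing, and the bound on the sum leaves enough for user 2. For
  \<open>p = 2\<close> there is no common rate to divide.\<close>

lemma common_share_exists:
  fixes p d1 d2 :: real
  assumes "p \<le> 2" "d1 \<le> 1" "d2 \<le> 1" "d1 + d2 \<le> (2 + p) / 2"
  obtains l where "0 \<le> l" "l \<le> 1" "2 * d1 \<le> p + l * (2 - p)" "2 * d2 \<le> p + (1 - l) * (2 - p)"
proof (cases "p = 2 \<or> 2 * d1 \<le> p")
  case True
  then show ?thesis using assms by (intro that[of 0]) auto
next
  case False
  then have "(2 * d1 - p) / (2 - p) * (2 - p) = 2 * d1 - p" by simp
  with False show ?thesis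
    using assms by (intro that[of "(2 * d1 - p) / (2 - p)"]) (auto simp: left_diff_distrib)
qed

theorem theorem1:
  fixes M :: "'w measure"
    and H He :: "user \<Rightarrow> real \<Rightarrow> nat \<Rightarrow> 'w \<Rightarrow> cvec"
    and Z :: "user \<Rightarrow> nat \<Rightarrow> 'w \<Rightarrow> complex"
    and \<mu> :: "cvec measure"
    and \<alpha> \<beta> d1 d2 :: real
  assumes "alternating_csit M H He Z \<mu> \<alpha> \<beta>"
    and "0 \<le> \<alpha>" and "\<alpha> \<le> \<beta>" and "\<beta> \<le> 1"
    and "(d1, d2) \<in> dof_region \<alpha> \<beta>"
  shows "miso_bc.dof_achievable M H He Z d1 d2"
proof -
  interpret alternating_csit M H He Z \<mu> \<alpha> \<beta> by (rule assms(1))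
  have region: "0 \<le> d1" "d1 \<le> 1" "0 \<le> d2" "d2 \<le> 1" "d1 + d2 \<le> (2 + (\<alpha> + \<beta>)) / 2"
    using dof_region_bounds[OF assms(5,2-4)] by auto
  obtain l where l: "0 \<le> l" "l \<le> 1" "2 * d1 \<le> \<alpha> + \<beta> + l * (2 - (\<alpha> + \<beta>))"
    "2 * d2 \<le> \<alpha> + \<beta> + (1 - l) * (2 - (\<alpha> + \<beta>))"
    using common_share_exists[of "\<alpha> + \<beta>" d1 d2] region assms(2-4) by auto
  define d where "d u = (if u = User1 then d1 else d2)" for u
  define s where "s u = (if u = User1 then l else 1 - l)" for u
  have "dof_achievable (d User1) (d User2)"
    by (rule dof_achievable_split[OF assms(2-4), where l = s])
      (use region l in \<open>auto simp: d_def s_def algebra_simps\<close>)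
  then show ?thesis by (simp add: d_def)
qed

end
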